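(* Let $n,c$ be positive integers. A plane partition $\pi=(\pi_{i,j})_{1\le i,j\le n}$ inside an $(n,n,c)$-box is called quasi transpose-complementary if $\pi_{i,j}+\pi_{n+1-j,n+1-i}=c$ for all $1\le i,j\le n$ with $i\ne n+1-j$. Then the number of quasi transpose-complementary plane partitions inside an $(n,n,c)$-box equals the number of symmetric plane partitions inside an $(n,n,c)$-box.
   Context: A plane partition inside an $(a,b,c)$-box is an array $(\pi_{i,j})_{1\le i\le a,1\le j\le b}$ of integers with $0\le\pi_{i,j}\le c$, weakly decreasing along rows and columns ($\pi_{i,j}\ge\pi_{i+1,j}$, $\pi_{i,j}\ge\pi_{i,j+1}$). It is symmetric (for $a=b$) if $\pi_{i,j}=\pi_{j,i}$ for all $i,j$. *)

theory Defs
  imports Main "HOL-Library.FuncSet"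
begin

text \<open>
  An array is a function on index pairs that is extensional on
  \<open>{1..a} \<times> {1..b}\<close> (constantly \<open>undefined\<close> elsewhere), so that equality of such
  functions is equality of arrays and \<open>card\<close> counts arrays.
\<close>

definition plane_partitions :: "nat \<Rightarrow> nat \<Rightarrow> nat \<Rightarrow> (nat \<times> nat \<Rightarrow> int) set" where
  "plane_partitions a b c =
    {\<pi> \<in> {1..a} \<times> {1..b} \<rightarrow>\<^sub>E {0..int c}.
      (\<forall>i j. 1 \<le> i \<and> i + 1 \<le> a \<and> 1 \<le> j \<and> j \<le> b \<longrightarrow> \<pi> (i, j) \<ge> \<pi> (i + 1, j)) \<and>
      (\<forall>i j. 1 \<le> i \<and> i \<le> a \<and> 1 \<le> j \<and> j + 1 \<le> b \<longrightarrow> \<pi> (i, j) \<ge> \<pi> (i, j + 1))}"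

lemma finite_plane_partitions: "finite (plane_partitions a b c)"
  unfolding plane_partitions_def by (simp add: finite_PiE)

definition symmetric_pp :: "nat \<Rightarrow> (nat \<times> nat \<Rightarrow> int) \<Rightarrow> bool" where
  "symmetric_pp n \<pi> \<longleftrightarrow> (\<forall>i\<in>{1..n}. \<forall>j\<in>{1..n}. \<pi> (i, j) = \<pi> (j, i))"

definition quasi_transpose_complementary :: "nat \<Rightarrow> nat \<Rightarrow> (nat \<times> nat \<Rightarrow> int) \<Rightarrow> bool" where
  "quasi_transpose_complementary n c \<pi> \<longleftrightarrow>
    (\<forall>i\<in>{1..n}. \<forall>j\<in>{1..n}.
      i \<noteq> n + 1 - j \<longrightarrow> \<pi> (i, j) + \<pi> (n + 1 - j, n + 1 - i) = int c)"

end

theory Submission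
  imports Defs "Jordan_Normal_Form.Determinant" "HOL-Combinatorics.Permutations"
begin

text \<open>
  Slicing a symmetric plane partition along its diagonals gives a Gelfand--Tsetlin pattern whose
  last row is free, so symmetric plane partitions are counted by a sum of determinants
  \<open>det [b\<^sub>j(x\<^sub>i)]\<close> over all increasing sequences \<open>x\<close> in an interval. A quasi transpose-complementary
  plane partition is cut by its main diagonal into two orthogonal Gelfand--Tsetlin patterns with
  a common last row \<open>y\<close>. For every family \<open>f\<close> of functions with \<open>f\<^sub>0 = 1\<close>, central difference
  \<open>\<delta> f\<^sub>m\<^sub>+\<^sub>1 = f\<^sub>m\<close> and parity \<open>(-1)\<^sup>m\<close>, such patterns are counted by a determinant
  \<open>det [f\<^sub>2\<^sub>j\<^sub>+\<^sub>e(y\<^sub>i)]\<close>, because summation over interlacing rows telescopes. The freedom in \<open>f\<close> is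
  essential: one half is counted with the central binomials \<open>b\<close>, the other with their averages
  \<open>(b\<^sub>m(x + 1) + b\<^sub>m(x - 1)) / 2\<close>.

  It remains to turn a sum of determinants into a sum of products of two determinants. Summing out
  every other variable of \<open>x\<close> leaves determinants in which the rows come in pairs \<open>(S(y\<^sub>i), r(y\<^sub>i))\<close>
  with \<open>S\<close> the partial sums of \<open>r\<close>. As \<open>r\<close> splits into an even and an odd part and the interval is symmetric,
  each pair may be replaced by one whose first row is supported on the even columns and whose
  second row on the odd columns, and the determinant factors.
\<close>

section \<open>Determinants\<close>

text \<open>Central binomials are used instead of ordinary ones because every symmetry in the
  argument is a reflection about a midpoint: it separates even from odd columns and it folds the
  boundary at the antidiagonal. Both uses need functions of definite parity. The averages are then
  forced. Summing f_m over all points below y and subtracting the sum over all points above y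
  telescopes to f_(m+1)(x - 1) + f_(m+1)(x + 1) up to a constant, where x = 2y - N; as y itself
  belongs to neither sum, the two ends do not meet in one argument. Averaging preserves the three
  defining properties of a family, so the averages count the same patterns, and the square of a
  single chain count can be written as a product of two different determinants. Two obstacles shape
  the rest. Pairing rows needs an even number of variables, so odd side lengths require a border.
  And replacing pairs requires variables that range independently, whereas partitions yield
  increasing sequences; passing to tuples and back costs factorials, which cancel.\<close>

definition rdet :: "nat \<Rightarrow> (nat \<Rightarrow> nat \<Rightarrow> real) \<Rightarrow> real" where
  "rdet n R = det (mat n n (\<lambda>(i, j). R i j))"

lemma rdet_1 [simp]: "rdet (Suc 0) R = R 0 0"
  by (simp add: rdet_def det_single)

lemma rdet_Leibniz:
  "rdet n R = (\<Sum>p | p permutes {..<n}. of_int (sign p) * (\<Prod>i<n. R i (p i)))"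
proof -
  have "(\<Prod>i = 0..<n. mat n n (\<lambda>(i, j). R i j) $$ (i, p i)) = (\<Prod>i<n. R i (p i))"
    if "p permutes {0..<n}" for p
    using that permutes_in_image[OF that]
    by (intro prod.cong) (auto simp: atLeast0LessThan)
  then show ?thesis
    unfolding rdet_def det_def by (auto simp: atLeast0LessThan intro!: sum.cong)
qed

lemma rdet_cong:
  assumes "\<And>i j. i < n \<Longrightarrow> j < n \<Longrightarrow> R i j = R' i j"
  shows "rdet n R = rdet n R'"
  unfolding rdet_def using assms by (intro arg_cong[where f = det] eq_matI) auto

lemma rdet_transpose: "rdet n (\<lambda>i j. R j i) = rdet n R"
proof -
  have "mat n n (\<lambda>(i, j). R j i) = transpose_mat (mat n n (\<lambda>(i, j). R i j))"
    by (rule eq_matI) auto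
  then show ?thesis
    unfolding rdet_def by (simp add: det_transpose[of _ n])
qed

text \<open>Multilinearity in all rows at once. The rows that interlace with a given row form a
  product of intervals, so a sum of determinants over them becomes one determinant of sums.\<close>

lemma rdet_row_sums:
  assumes "\<And>i. i < n \<Longrightarrow> finite (Z i)"
  shows "rdet n (\<lambda>i j. \<Sum>z\<in>Z i. G i z j) = (\<Sum>z\<in>Pi\<^sub>E {..<n} Z. rdet n (\<lambda>i. G i (z i)))"
proof -
  have "(\<Prod>i<n. \<Sum>z\<in>Z i. G i z (p i)) = (\<Sum>z\<in>Pi\<^sub>E {..<n} Z. \<Prod>i<n. G i (z i) (p i))" for p
    using assms by (intro prod_sum_PiE) auto
  then show ?thesis
    unfolding rdet_Leibniz
    by (subst sum.swap) (simp add: sum_distrib_left)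
qed

lemma rdet_scale_rows: "rdet n (\<lambda>i j. k i * R i j) = (\<Prod>i<n. k i) * rdet n R"
  unfolding rdet_Leibniz by (simp add: prod.distrib sum_distrib_left mult_ac)

lemma rdet_scale_cols: "rdet n (\<lambda>i j. k j * R i j) = (\<Prod>j<n. k j) * rdet n R"
  using rdet_scale_rows[of n k "\<lambda>i j. R j i"] rdet_transpose[of n R]
    rdet_transpose[of n "\<lambda>i j. k j * R i j"] by simp

lemma rdet_permute_rows:
  assumes "p permutes {..<n}"
  shows "rdet n (\<lambda>i. R (p i)) = of_int (sign p) * rdet n R"
proof -
  have "mat n n (\<lambda>(i, j). R (p i) j) = mat n n (\<lambda>(i, j). mat n n (\<lambda>(i, j). R i j) $$ (p i, j))"
    using permutes_in_image[OF assms] by (intro eq_matI) auto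
  then show ?thesis
    unfolding rdet_def using assms
    by (simp add: det_permute_rows[of _ n] atLeast0LessThan)
qed

lemma rdet_permute_cols:
  assumes "p permutes {..<n}"
  shows "rdet n (\<lambda>i j. R i (p j)) = of_int (sign p) * rdet n R"
  using rdet_permute_rows[OF assms, of "\<lambda>i j. R j i"] rdet_transpose[of n R]
    rdet_transpose[of n "\<lambda>i j. R i (p j)"] by simp

lemma rdet_equal_rows:
  assumes "i < n" "j < n" "i \<noteq> j" "\<And>l. l < n \<Longrightarrow> R i l = R j l"
  shows "rdet n R = 0"
  unfolding rdet_def using assms
  by (intro det_identical_rows[of _ n i j]) (auto intro!: eq_vecI)

lemma rdet_zero_row:
  assumes "i < n" "\<And>l. l < n \<Longrightarrow> R i l = 0"
  shows "rdet n R = 0"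
proof -
  have "R i (p i) = 0" if "p permutes {..<n}" for p
    using that assms permutes_in_image[OF that, of i] by auto
  then show ?thesis
    unfolding rdet_Leibniz using assms(1) by (intro sum.neutral) (auto intro!: prod_zero)
qed

text \<open>Multiplication from the left by a lower unitriangular matrix. The multiples are those of
  the original rows, so all additions happen simultaneously.\<close>

lemma rdet_add_earlier_rows:
  "rdet n (\<lambda>i j. R i j + (\<Sum>l<i. a i l * R l j)) = rdet n R"
proof -
  define L where "L = mat n n (\<lambda>(i, l). if i = l then 1 else if l < i then a i l else (0 :: real))"
  have L: "L \<in> carrier_mat n n" by (simp add: L_def)
  have "diag_mat L = replicate n 1"
    unfolding diag_mat_def L_def by (intro nth_equalityI) auto
  then have "det L = 1"
    by (subst det_lower_triangular[OF _ L]) (auto simp: L_def)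
  have "mat n n (\<lambda>(i, j). R i j + (\<Sum>l<i. a i l * R l j)) = L * mat n n (\<lambda>(i, j). R i j)"
  proof (rule eq_matI; simp add: L_def scalar_prod_def)
    fix i j assume ij: "i < n" "j < n"
    have "(\<Sum>l = 0..<n. (if i = l then 1 else if l < i then a i l else 0) * R l j)
        = (\<Sum>l\<in>insert i {..<i}. (if i = l then 1 else if l < i then a i l else 0) * R l j)"
      using ij by (intro sum.mono_neutral_right) auto
    then show "R i j + (\<Sum>l<i. a i l * R l j)
        = (\<Sum>l = 0..<n. (if i = l then 1 else if l < i then a i l else 0) * R l j)"
      by simp
  qed
  then show ?thesis
    unfolding rdet_def using \<open>det L = 1\<close> by (simp add: det_mult[OF L])
qed

lemma rdet_add_earlier_cols:
  "rdet n (\<lambda>i j. R i j + (\<Sum>l<j. a j l * R i l)) = rdet n R"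
  using rdet_add_earlier_rows[of n "\<lambda>i j. R j i" a] rdet_transpose[of n R]
    rdet_transpose[of n "\<lambda>i j. R i j + (\<Sum>l<j. a j l * R i l)"] by simp

lemma rdet_row_differences:
  "rdet n (\<lambda>i j. if i = 0 then R i j else R i j - R (i - 1) j) = rdet n R"
proof -
  have "rdet n (\<lambda>i j. if i = 0 then R i j else R i j - R (i - 1) j)
      = rdet n (\<lambda>i j. R i j + (\<Sum>l<i. (if Suc l = i then -1 else 0) * R l j))"
  proof (rule rdet_cong)
    fix i j
    show "(if i = 0 then R i j else R i j - R (i - 1) j)
        = R i j + (\<Sum>l<i. (if Suc l = i then -1 else 0) * R l j)"
      by (cases i) (auto simp: sum.delta if_distrib[of "\<lambda>x. x * _"] cong: if_cong)
  qed
  then show ?thesis by (simp add: rdet_add_earlier_rows)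
qed

lemma rdet_col0_unit:
  assumes "\<And>i. 0 < i \<Longrightarrow> i \<le> n \<Longrightarrow> R i 0 = 0"
  shows "rdet (Suc n) R = R 0 0 * rdet n (\<lambda>i j. R (Suc i) (Suc j))"
proof -
  define M where "M = mat (Suc n) (Suc n) (\<lambda>(i, j). R i j)"
  have "det M = (\<Sum>i<Suc n. M $$ (i, 0) * cofactor M i 0)"
    by (rule laplace_expansion_column) (auto simp: M_def)
  also have "\<dots> = (\<Sum>i\<in>{0}. M $$ (i, 0) * cofactor M i 0)"
    using assms by (intro sum.mono_neutral_right) (auto simp: M_def)
  also have "mat_delete M 0 0 = mat n n (\<lambda>(i, j). R (Suc i) (Suc j))"
    unfolding mat_delete_def M_def by (rule eq_matI) auto
  then have "(\<Sum>i\<in>{0}. M $$ (i, 0) * cofactor M i 0) = R 0 0 * rdet n (\<lambda>i j. R (Suc i) (Suc j))"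
    by (simp add: cofactor_def rdet_def M_def)
  finally show ?thesis unfolding rdet_def M_def .
qed

lemma rdet_first_row_unit:
  assumes "\<And>j. 0 < j \<Longrightarrow> j \<le> n \<Longrightarrow> R 0 j = 0"
  shows "rdet (Suc n) R = R 0 0 * rdet n (\<lambda>i j. R (Suc i) (Suc j))"
  using rdet_col0_unit[of n "\<lambda>i j. R j i"] assms
    rdet_transpose[of "Suc n" R] rdet_transpose[of n "\<lambda>i j. R (Suc i) (Suc j)"] by simp

lemma rdet_last_row_unit:
  assumes "\<And>j. 0 < j \<Longrightarrow> j \<le> n \<Longrightarrow> R n j = 0"
  shows "rdet (Suc n) R = (-1) ^ n * R n 0 * rdet n (\<lambda>i j. R i (Suc j))"
proof -
  define M where "M = mat (Suc n) (Suc n) (\<lambda>(i, j). R i j)"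
  have "det M = (\<Sum>j<Suc n. M $$ (n, j) * cofactor M n j)"
    by (rule laplace_expansion_row) (auto simp: M_def)
  also have "\<dots> = (\<Sum>j\<in>{0}. M $$ (n, j) * cofactor M n j)"
    using assms by (intro sum.mono_neutral_right) (auto simp: M_def)
  also have "mat_delete M n 0 = mat n n (\<lambda>(i, j). R i (Suc j))"
    unfolding mat_delete_def M_def by (rule eq_matI) auto
  then have "(\<Sum>j\<in>{0}. M $$ (n, j) * cofactor M n j) = (-1) ^ n * R n 0 * rdet n (\<lambda>i j. R i (Suc j))"
    by (simp add: cofactor_def rdet_def M_def)
  finally show ?thesis unfolding rdet_def M_def .
qed

text \<open>Differences of consecutive rows turn the constant column into the first unit vector.
  Read from right to left, this is how a determinant gains a row when sums telescope.\<close>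

lemma rdet_const_col0:
  assumes "\<And>i. i \<le> n \<Longrightarrow> R i 0 = 1"
  shows "rdet (Suc n) R = rdet n (\<lambda>i j. R (Suc i) (Suc j) - R i (Suc j))"
proof -
  have "rdet (Suc n) R = rdet (Suc n) (\<lambda>i j. if i = 0 then R i j else R i j - R (i - 1) j)"
    by (simp add: rdet_row_differences)
  also have "\<dots> = R 0 0 * rdet n (\<lambda>i j. R (Suc i) (Suc j) - R i (Suc j))"
    by (subst rdet_col0_unit) (use assms in auto)
  finally show ?thesis using assms by simp
qed

lemma rdet_checkerboard:
  assumes "\<And>i j. i < n + n \<Longrightarrow> j < n + n \<Longrightarrow> even i \<noteq> even j \<Longrightarrow> R i j = 0"
  shows "rdet (n + n) R = rdet n (\<lambda>i j. R (2 * i) (2 * j)) * rdet n (\<lambda>i j. R (2 * i + 1) (2 * j + 1))"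
proof -
  \<comment> \<open>\<open>p\<close> lists the even indices first and then the odd ones. It is
    applied to rows and to columns, so its sign occurs twice and cancels.\<close>
  define p where "p i = (if i < n then 2 * i else if i < n + n then 2 * (i - n) + 1 else i)" for i
  have inj: "inj_on p {..<n + n}"
    by (rule inj_onI) (auto simp: p_def split: if_splits, presburger+)
  moreover have "p ` {..<n + n} \<subseteq> {..<n + n}"
    by (auto simp: p_def)
  ultimately have bij: "bij_betw p {..<n + n} {..<n + n}"
    by (metis bij_betw_def endo_inj_surj finite_lessThan)
  then have p: "p permutes {..<n + n}"
    by (rule bij_imp_permutes) (auto simp: p_def)
  have "rdet (n + n) (\<lambda>i j. R (p i) (p j)) = of_int (sign p) * (of_int (sign p) * rdet (n + n) R)"
    using rdet_permute_rows[OF p, of "\<lambda>i j. R i (p j)"] rdet_permute_cols[OF p, of R] by simp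
  also have "\<dots> = rdet (n + n) R"
    by (simp add: sign_def)
  finally have "rdet (n + n) R = rdet (n + n) (\<lambda>i j. R (p i) (p j))" ..
  also have "\<dots> = det (four_block_mat (mat n n (\<lambda>(i, j). R (2 * i) (2 * j))) (0\<^sub>m n n)
      (0\<^sub>m n n) (mat n n (\<lambda>(i, j). R (2 * i + 1) (2 * j + 1))))"
    unfolding rdet_def
    by (intro arg_cong[where f = det] eq_matI) (auto simp: p_def intro!: assms)
  also have "\<dots> = rdet n (\<lambda>i j. R (2 * i) (2 * j)) * rdet n (\<lambda>i j. R (2 * i + 1) (2 * j + 1))"
    unfolding rdet_def by (subst det_four_block_mat_lower_left_zero) auto
  finally show ?thesis .
qed

lemma rdet_add_row:
  assumes "k < n"
  shows "rdet n (R(k := \<lambda>j. u j + v j)) = rdet n (R(k := u)) + rdet n (R(k := v))"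
proof -
  have split: "(\<Prod>i<n. (R(k := w)) i (p i)) = w (p k) * (\<Prod>i\<in>{..<n} - {k}. R i (p i))" for w p
    using assms by (subst prod.remove[of _ k]) (auto intro!: prod.cong)
  show ?thesis
    unfolding rdet_Leibniz split by (simp add: algebra_simps sum.distrib)
qed

section \<open>Sums over increasing sequences\<close>

text \<open>Additivity suffices in place of full linearity: the only scalars that have to be moved
  out are signs.\<close>

definition alternating :: "((nat \<Rightarrow> real) \<Rightarrow> (nat \<Rightarrow> real) \<Rightarrow> real) \<Rightarrow> bool" where
  "alternating \<alpha> \<longleftrightarrow>
    (\<forall>u v w. \<alpha> (\<lambda>j. u j + v j) w = \<alpha> u w + \<alpha> v w) \<and>
    (\<forall>u v w. \<alpha> w (\<lambda>j. u j + v j) = \<alpha> w u + \<alpha> w v) \<and>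
    (\<forall>u. \<alpha> u u = 0)"

context
  fixes \<alpha> assumes alt: "alternating \<alpha>"
begin

lemma alternating_add:
  "\<alpha> (\<lambda>j. u j + v j) w = \<alpha> u w + \<alpha> v w"
  "\<alpha> w (\<lambda>j. u j + v j) = \<alpha> w u + \<alpha> w v"
  using alt unfolding alternating_def by blast+

lemma alternating_zero: "\<alpha> (\<lambda>j. 0) w = 0" "\<alpha> w (\<lambda>j. 0) = 0"
  using alternating_add(1)[of "\<lambda>_. 0" "\<lambda>_. 0" w] alternating_add(2)[of w "\<lambda>_. 0" "\<lambda>_. 0"] by auto

lemma alternating_minus: "\<alpha> (\<lambda>j. - u j) w = - \<alpha> u w" "\<alpha> w (\<lambda>j. - u j) = - \<alpha> w u"
  using alternating_add(1)[of u "\<lambda>j. - u j" w] alternating_add(2)[of w u "\<lambda>j. - u j"]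
    alternating_zero[of w] by auto

lemma alternating_diff: "\<alpha> (\<lambda>j. u j - v j) w = \<alpha> u w - \<alpha> v w"
  using alternating_add(1)[of u "\<lambda>j. - v j" w] alternating_minus(1)[of v w] by simp

lemma alternating_sum: "\<alpha> (\<lambda>j. \<Sum>x\<in>S. f x j) w = (\<Sum>x\<in>S. \<alpha> (f x) w)"
  by (induction S rule: infinite_finite_induct) (simp_all add: alternating_zero alternating_add)

lemma alternating_self: "\<alpha> u u = 0"
  using alt unfolding alternating_def by blast

lemma alternating_commute: "\<alpha> u v = - \<alpha> v u"
  using alternating_self[of "\<lambda>j. u j + v j"]
  by (simp only: alternating_add alternating_self)

text \<open>
  Only the mixed terms of the double sum over \<open>x < y\<close> survive: the reversal
  \<open>(x, y) \<mapsto> (lo + hi - y, lo + hi - x)\<close> changes the sign of the others.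
\<close>

lemma alternating_sum_reflect:
  fixes p q :: "int \<Rightarrow> nat \<Rightarrow> real" and lo hi :: int and s :: real
  assumes s: "s = 1 \<or> s = -1"
    and p: "\<And>x j. x \<in> {lo..hi} \<Longrightarrow> p (lo + hi - x) j = s * p x j"
    and q: "\<And>x j. x \<in> {lo..hi} \<Longrightarrow> q (lo + hi - x) j = - s * q x j"
  shows "(\<Sum>y\<in>{lo..hi}. \<alpha> (\<lambda>j. \<Sum>x\<in>{lo..<y}. p x j + q x j) (\<lambda>j. p y j + q y j))
    = (\<Sum>y\<in>{lo..hi}. \<alpha> (\<lambda>j. (\<Sum>x\<in>{lo..<y}. p x j) - (\<Sum>x\<in>{y<..hi}. p x j)) (q y))"
proof -
  define T where "T = (SIGMA y:{lo..hi}. {lo..<y})"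
  have fin: "finite T" unfolding T_def by simp
  have reflect: "(\<Sum>(y, x)\<in>T. \<alpha> (f x) (g y)) = (\<Sum>(y, x)\<in>T. \<alpha> (f (lo + hi - y)) (g (lo + hi - x)))"
    for f g :: "int \<Rightarrow> nat \<Rightarrow> real"
    by (rule sum.reindex_bij_witness[of _ "\<lambda>(y, x). (lo + hi - x, lo + hi - y)"
          "\<lambda>(y, x). (lo + hi - x, lo + hi - y)"]) (auto simp: T_def)
  have fun_eq: "p (lo + hi - x) = (\<lambda>j. s * p x j)" "q (lo + hi - x) = (\<lambda>j. - s * q x j)"
    if "x \<in> {lo..hi}" for x
    using p q that by auto
  have pp': "\<alpha> (p (lo + hi - y)) (p (lo + hi - x)) = - \<alpha> (p x) (p y)"
    and qq': "\<alpha> (q (lo + hi - y)) (q (lo + hi - x)) = - \<alpha> (q x) (q y)"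
    and qp': "\<alpha> (q (lo + hi - y)) (p (lo + hi - x)) = \<alpha> (p x) (q y)"
    and pq': "\<alpha> (p (lo + hi - y)) (q (lo + hi - x)) = - \<alpha> (p y) (q x)"
    if "(y, x) \<in> T" for x y
    using s that fun_eq[of x] fun_eq[of y] alternating_commute[of "p y" "p x"]
      alternating_commute[of "q y" "q x"] alternating_commute[of "q y" "p x"]
    by (auto simp: T_def alternating_minus)
  have pp: "(\<Sum>(y, x)\<in>T. \<alpha> (p x) (p y)) = 0"
  proof -
    have "(\<Sum>(y, x)\<in>T. \<alpha> (p x) (p y)) = (\<Sum>(y, x)\<in>T. - \<alpha> (p x) (p y))"
      unfolding reflect[of p p] by (rule sum.cong) (auto simp: pp')
    then show ?thesis by (simp add: sum_negf case_prod_unfold)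
  qed
  have qq: "(\<Sum>(y, x)\<in>T. \<alpha> (q x) (q y)) = 0"
  proof -
    have "(\<Sum>(y, x)\<in>T. \<alpha> (q x) (q y)) = (\<Sum>(y, x)\<in>T. - \<alpha> (q x) (q y))"
      unfolding reflect[of q q] by (rule sum.cong) (auto simp: qq')
    then show ?thesis by (simp add: sum_negf case_prod_unfold)
  qed
  have qp: "(\<Sum>(y, x)\<in>T. \<alpha> (q x) (p y)) = (\<Sum>(y, x)\<in>T. \<alpha> (p x) (q y))"
    unfolding reflect[of q p] by (rule sum.cong) (auto simp: qp')
  have pq: "(\<Sum>(y, x)\<in>T. \<alpha> (p x) (q y)) = - (\<Sum>(y, x)\<in>T. \<alpha> (p y) (q x))"
    unfolding reflect[of p q] by (subst sum_negf[symmetric], rule sum.cong) (auto simp: pq')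
  have "(\<Sum>y\<in>{lo..hi}. \<alpha> (\<lambda>j. \<Sum>x\<in>{lo..<y}. p x j + q x j) (\<lambda>j. p y j + q y j))
      = (\<Sum>(y, x)\<in>T. \<alpha> (\<lambda>j. p x j + q x j) (\<lambda>j. p y j + q y j))"
    unfolding T_def by (simp add: alternating_sum sum.Sigma)
  also have "\<dots> = (\<Sum>(y, x)\<in>T. \<alpha> (p x) (p y)) + (\<Sum>(y, x)\<in>T. \<alpha> (q x) (q y))
      + (\<Sum>(y, x)\<in>T. \<alpha> (p x) (q y)) + (\<Sum>(y, x)\<in>T. \<alpha> (q x) (p y))"
    by (simp add: alternating_add case_prod_unfold sum.distrib)
  \<comment> \<open>The two mixed sums are equal, and either of them is minus the sum with
    \<open>p\<close> at the larger argument. Using both expressions puts \<open>q\<close> at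
    \<open>y\<close> throughout, with \<open>p\<close> collected positively from below
    \<open>y\<close> and negatively from above.\<close>
  also have "\<dots> = (\<Sum>(y, x)\<in>T. \<alpha> (p x) (q y)) - (\<Sum>(y, x)\<in>T. \<alpha> (p y) (q x))"
    using pp qq qp pq by simp
  also have "(\<Sum>(y, x)\<in>T. \<alpha> (p y) (q x)) = (\<Sum>(x, y)\<in>(SIGMA x:{lo..hi}. {x<..hi}). \<alpha> (p y) (q x))"
    by (rule sum.reindex_bij_witness[of _ prod.swap prod.swap]) (auto simp: T_def)
  also have "(\<Sum>(y, x)\<in>T. \<alpha> (p x) (q y)) - \<dots>
     = (\<Sum>y\<in>{lo..hi}. \<alpha> (\<lambda>j. (\<Sum>x\<in>{lo..<y}. p x j) - (\<Sum>x\<in>{y<..hi}. p x j)) (q y))"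
    unfolding T_def by (simp add: alternating_sum alternating_diff sum.Sigma[symmetric] sum_subtractf)
  finally show ?thesis .
qed

end

section \<open>Determinants whose rows come in pairs\<close>

definition paired_det :: "nat \<Rightarrow> (nat \<Rightarrow> nat \<Rightarrow> real) \<Rightarrow> (nat \<Rightarrow> nat \<Rightarrow> real) \<Rightarrow> real" where
  "paired_det m U V = rdet (m + m) (\<lambda>i. if even i then U (i div 2) else V (i div 2))"

lemma paired_det_update:
  "paired_det m (U(k := u)) (V(k := v))
    = rdet (m + m) ((\<lambda>i. if even i then U (i div 2) else V (i div 2))(2 * k := u, 2 * k + 1 := v))"
proof -
  let ?R = "\<lambda>U V i. if even i then U (i div 2) else V (i div 2)"
  have "?R (U(k := u)) (V(k := v)) i = ((?R U V)(2 * k := u, 2 * k + 1 := v)) i" for i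
  proof (cases "even i")
    case True
    then obtain a where "i = 2 * a" by (elim evenE)
    then show ?thesis by simp
  next
    case False
    then obtain a where "i = 2 * a + 1" by (elim oddE)
    then show ?thesis by simp
  qed
  then show ?thesis
    unfolding paired_det_def by presburger
qed

text \<open>With all other pairs fixed, an identity that holds for every alternating form can be
  applied to pair \<open>k\<close> inside the determinant.\<close>

lemma alternating_paired_det:
  assumes "k < m"
  shows "alternating (\<lambda>u v. paired_det m (U(k := u)) (V(k := v)))"
proof -
  have self: "rdet (m + m) (R(2 * k := u, 2 * k + 1 := u)) = 0" for R u
    using assms by (intro rdet_equal_rows[of "2 * k" _ "2 * k + 1"]) auto
  have left: "rdet (m + m) (R(2 * k := \<lambda>j. u j + v j, 2 * k + 1 := w))
      = rdet (m + m) (R(2 * k := u, 2 * k + 1 := w)) + rdet (m + m) (R(2 * k := v, 2 * k + 1 := w))"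
    for R u v w
    using assms rdet_add_row[of "2 * k" "m + m" "R(2 * k + 1 := w)" u v]
    by (simp add: fun_upd_twist[of "Suc (2 * k)" "2 * k" R])
  have right: "rdet (m + m) (R(2 * k := w, 2 * k + 1 := \<lambda>j. u j + v j))
      = rdet (m + m) (R(2 * k := w, 2 * k + 1 := u)) + rdet (m + m) (R(2 * k := w, 2 * k + 1 := v))"
    for R u v w
    using assms by (intro rdet_add_row) auto
  show ?thesis
    unfolding alternating_def paired_det_update
    by (intro conjI allI left right self)
qed

lemma sum_PiE_lessThan_Suc:
  fixes k :: nat
  shows "(\<Sum>y\<in>{..<Suc k} \<rightarrow>\<^sub>E X. f y) = (\<Sum>z\<in>X. \<Sum>y\<in>{..<k} \<rightarrow>\<^sub>E X. f (y(k := z)))"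
proof -
  have "{..<Suc k} \<rightarrow>\<^sub>E X = (\<lambda>(z, y). y(k := z)) ` (X \<times> ({..<k} \<rightarrow>\<^sub>E X))"
    by (simp add: lessThan_Suc PiE_insert_eq)
  moreover have "inj_on (\<lambda>(z, y). y(k := z)) (X \<times> ({..<k} \<rightarrow>\<^sub>E X))"
    by (rule inj_combinator) simp
  ultimately show ?thesis
    by (simp add: sum.reindex sum.cartesian_product case_prod_unfold)
qed

text \<open>Pairs are replaced one at a time. Each variable has to range over \<open>X\<close>
  independently of the others, hence the product set in place of increasing sequences.\<close>

lemma sum_paired_det_replace:
  assumes eq: "\<And>\<alpha>. alternating \<alpha> \<Longrightarrow> (\<Sum>x\<in>X. \<alpha> (P x) (Q x)) = (\<Sum>x\<in>X. \<alpha> (P' x) (Q' x))"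
  shows "k \<le> m \<Longrightarrow>
    (\<Sum>y\<in>{..<k} \<rightarrow>\<^sub>E X. paired_det m (\<lambda>i. if i < k then P (y i) else U i) (\<lambda>i. if i < k then Q (y i) else V i))
    = (\<Sum>y\<in>{..<k} \<rightarrow>\<^sub>E X. paired_det m (\<lambda>i. if i < k then P' (y i) else U i) (\<lambda>i. if i < k then Q' (y i) else V i))"
proof (induction k arbitrary: U V)
  case 0
  then show ?case by simp
next
  case (Suc k)
  define ext where "ext k P U y = (\<lambda>i. if i < k then P (y i) else U i)"
    for k P and U :: "nat \<Rightarrow> nat \<Rightarrow> real" and y :: "nat \<Rightarrow> 'a"
  have upd: "ext (Suc k) P U (y(k := z)) = ext k P (U(k := P z)) y" for P U y z
    by (auto simp: ext_def fun_eq_iff less_Suc_eq)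
  have upd': "ext k P (U(k := u)) y = (ext k P U y)(k := u)" for P U y u
    by (auto simp: ext_def fun_eq_iff)
  have key: "(\<Sum>z\<in>X. paired_det m (U(k := P z)) (V(k := Q z)))
      = (\<Sum>z\<in>X. paired_det m (U(k := P' z)) (V(k := Q' z)))" for U V
    by (rule eq[OF alternating_paired_det[of k m U V]]) (use Suc.prems in simp)
  \<comment> \<open>Pair \<open>k\<close> with its old entries is parked in \<open>U\<close> and
    \<open>V\<close> while the pairs before it are replaced; only then is its own variable
    summed.\<close>
  have IH: "(\<Sum>y\<in>{..<k} \<rightarrow>\<^sub>E X. paired_det m (ext k P U y) (ext k Q V y))
      = (\<Sum>y\<in>{..<k} \<rightarrow>\<^sub>E X. paired_det m (ext k P' U y) (ext k Q' V y))" for U V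
    unfolding ext_def by (rule Suc.IH) (use Suc.prems in simp)
  have "(\<Sum>y\<in>{..<Suc k} \<rightarrow>\<^sub>E X. paired_det m (ext (Suc k) P U y) (ext (Suc k) Q V y))
      = (\<Sum>z\<in>X. \<Sum>y\<in>{..<k} \<rightarrow>\<^sub>E X. paired_det m (ext k P (U(k := P z)) y) (ext k Q (V(k := Q z)) y))"
    unfolding sum_PiE_lessThan_Suc upd ..
  also have "\<dots> = (\<Sum>z\<in>X. \<Sum>y\<in>{..<k} \<rightarrow>\<^sub>E X. paired_det m (ext k P' (U(k := P z)) y) (ext k Q' (V(k := Q z)) y))"
    by (intro sum.cong refl IH)
  also have "\<dots> = (\<Sum>y\<in>{..<k} \<rightarrow>\<^sub>E X. \<Sum>z\<in>X. paired_det m ((ext k P' U y)(k := P z)) ((ext k Q' V y)(k := Q z)))"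
    unfolding upd' by (rule sum.swap)
  also have "\<dots> = (\<Sum>y\<in>{..<k} \<rightarrow>\<^sub>E X. \<Sum>z\<in>X. paired_det m ((ext k P' U y)(k := P' z)) ((ext k Q' V y)(k := Q' z)))"
    by (simp only: key)
  also have "\<dots> = (\<Sum>z\<in>X. \<Sum>y\<in>{..<k} \<rightarrow>\<^sub>E X. paired_det m (ext k P' (U(k := P' z)) y) (ext k Q' (V(k := Q' z)) y))"
    unfolding upd' by (rule sum.swap)
  also have "\<dots> = (\<Sum>y\<in>{..<Suc k} \<rightarrow>\<^sub>E X. paired_det m (ext (Suc k) P' U y) (ext (Suc k) Q' V y))"
    unfolding sum_PiE_lessThan_Suc upd ..
  finally show ?case
    unfolding ext_def .
qed

section \<open>Increasing sequences and symmetric sums\<close>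

definition incseqs :: "nat \<Rightarrow> int set \<Rightarrow> (nat \<Rightarrow> int) set" where
  "incseqs n X = {x \<in> {..<n} \<rightarrow>\<^sub>E X. \<forall>i. Suc i < n \<longrightarrow> x i < x (Suc i)}"

lemma incseqs_less:
  assumes "x \<in> incseqs n X" "i < j" "j < n"
  shows "x i < x j"
  using assms(2,3)
proof (induction j)
  case (Suc j)
  then have "x j < x (Suc j)"
    using assms(1) by (simp add: incseqs_def)
  with Suc show ?case by (cases "i = j") auto
qed simp

lemma incseqs_inj_on: "x \<in> incseqs n X \<Longrightarrow> inj_on x {..<n}"
  by (rule linorder_inj_onI) (auto dest: incseqs_less)

lemma finite_incseqs [simp]: "finite X \<Longrightarrow> finite (incseqs n X)"
  by (simp add: incseqs_def finite_PiE)

lemma incseqs_image_unique: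
  assumes x: "x \<in> incseqs n X" and y: "y \<in> incseqs n X" and "x ` {..<n} = y ` {..<n}"
  shows "x = y"
proof -
  have "sorted_wrt (<) (map z [0..<n])" if "z \<in> incseqs n X" for z
    using that by (auto simp: sorted_wrt_iff_nth_less intro: incseqs_less)
  then have "map x [0..<n] = map y [0..<n]"
    using assms by (intro sorted_distinct_set_unique)
      (auto simp: strict_sorted_iff atLeast0LessThan)
  moreover have "x \<in> extensional {..<n}" "y \<in> extensional {..<n}"
    using x y by (auto simp: incseqs_def PiE_def)
  ultimately show ?thesis
    by (intro extensionalityI[of _ "{..<n}"]) auto
qed

lemma permutation_of_incseq:
  assumes y: "y \<in> {..<n} \<rightarrow>\<^sub>E X" and inj: "inj_on y {..<n}"
  obtains p x where "p permutes {..<n}" "x \<in> incseqs n X" "y = x \<circ> p"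
proof -
  define ys where "ys = map y [0..<n]"
  define xs where "xs = sort ys"
  have len: "length xs = n" by (simp add: xs_def ys_def)
  have "mset ys = mset xs" by (simp add: xs_def)
  then obtain p where p: "p permutes {..<length xs}" "permute_list p xs = ys"
    by (rule mset_eq_permutation)
  have "distinct ys"
    using inj by (simp add: ys_def distinct_map atLeast0LessThan)
  then have "sorted_wrt (<) xs"
    by (simp add: xs_def strict_sorted_iff)
  then have less: "xs ! i < xs ! Suc i" if "Suc i < n" for i
    using that len by (simp add: sorted_wrt_iff_nth_less)
  have "set xs \<subseteq> X"
    using PiE_mem[OF y] by (auto simp: xs_def ys_def)
  then have mem: "xs ! i \<in> X" if "i < n" for i
    using that len nth_mem[of i xs] by blast
  define x where "x = (\<lambda>i\<in>{..<n}. xs ! i)"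
  have "x \<in> incseqs n X"
    by (auto simp: incseqs_def x_def less mem)
  moreover have "y i = x (p i)" for i
  proof (cases "i < n")
    case True
    then have "p i < n" using p(1) len permutes_in_image[of p "{..<n}" i] by simp
    have "y i = ys ! i" using True by (simp add: ys_def)
    also have "\<dots> = xs ! p i"
      using True len p by (metis permute_list_nth)
    finally show ?thesis using \<open>p i < n\<close> by (simp add: x_def)
  next
    case False
    then have "p i = i" using p(1) len permutes_not_in[of p "{..<n}" i] by simp
    with False y show ?thesis by (auto simp: x_def PiE_def extensional_def)
  qed
  ultimately show thesis using p(1) len that by force
qed

text \<open>Every injective tuple is an increasing sequence composed with a permutation, both
  unique, and tuples with a repetition contribute nothing. Invariance is demanded for transpositions
  only, since these generate all permutations.\<close>

lemma sum_symmetric: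
  fixes h :: "(nat \<Rightarrow> int) \<Rightarrow> real"
  assumes "finite X"
    and swap: "\<And>y a b. a < n \<Longrightarrow> b < n \<Longrightarrow> a \<noteq> b \<Longrightarrow> h (y \<circ> Transposition.transpose a b) = h y"
    and zero: "\<And>y. y \<in> {..<n} \<rightarrow>\<^sub>E X \<Longrightarrow> \<not> inj_on y {..<n} \<Longrightarrow> h y = 0"
  shows "(\<Sum>y\<in>{..<n} \<rightarrow>\<^sub>E X. h y) = fact n * (\<Sum>y\<in>incseqs n X. h y)"
proof -
  have perm: "h (y \<circ> p) = h y" if "p permutes {..<n}" for y p
    using that finite_lessThan[of n]
  proof (induction arbitrary: y rule: permutes_induct)
    case id
    show ?case by simp
  next
    case (swap a b p)
    have "h (y \<circ> (Transposition.transpose a b \<circ> p)) = h (y \<circ> Transposition.transpose a b)"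
      unfolding comp_assoc[symmetric] by (rule swap.IH)
    also have "\<dots> = h y"
      using swap.hyps by (intro assms(2)) auto
    finally show ?case .
  qed
  define S where "S = {p. p permutes {..<n}} \<times> incseqs n X"
  have inj: "inj_on (\<lambda>(p, y). y \<circ> p) S"
  proof (rule inj_onI, clarify)
    fix p x q y assume "(p, x) \<in> S" "(q, y) \<in> S" and eq: "x \<circ> p = y \<circ> q"
    then have p: "p permutes {..<n}" and q: "q permutes {..<n}"
      and x: "x \<in> incseqs n X" and y: "y \<in> incseqs n X"
      by (auto simp: S_def)
    have "x ` {..<n} = (x \<circ> p) ` {..<n}"
      using permutes_image[OF p] by (metis image_comp)
    also have "\<dots> = y ` {..<n}"
      unfolding eq using permutes_image[OF q] by (metis image_comp)
    finally have "x = y" using x y by (rule incseqs_image_unique[rotated 2])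
    have "p i = q i" for i
    proof (cases "i < n")
      case True
      then have "p i < n" "q i < n"
        using permutes_in_image[OF p, of i] permutes_in_image[OF q, of i] by auto
      moreover have "x (p i) = x (q i)"
        using eq \<open>x = y\<close> by (metis comp_apply)
      ultimately show ?thesis
        using incseqs_inj_on[OF x] by (auto dest: inj_onD)
    next
      case False
      then show ?thesis
        using permutes_not_in[OF p, of i] permutes_not_in[OF q, of i] by simp
    qed
    with \<open>x = y\<close> show "p = q \<and> x = y" by auto
  qed
  have img: "(\<lambda>(p, y). y \<circ> p) ` S = {y \<in> {..<n} \<rightarrow>\<^sub>E X. inj_on y {..<n}}"
  proof (intro equalityI subsetI)
    fix z assume "z \<in> (\<lambda>(p, y). y \<circ> p) ` S"
    then obtain p x where z: "z = x \<circ> p" and p: "p permutes {..<n}" and x: "x \<in> incseqs n X"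
      by (auto simp: S_def)
    have "inj_on (x \<circ> p) {..<n}"
      using incseqs_inj_on[OF x] permutes_image[OF p] permutes_inj_on[OF p]
      by (intro comp_inj_on) auto
    moreover have "x \<circ> p \<in> {..<n} \<rightarrow>\<^sub>E X"
      using x permutes_in_image[OF p] permutes_not_in[OF p]
      by (auto simp: incseqs_def PiE_def extensional_def Pi_def)
    ultimately show "z \<in> {y \<in> {..<n} \<rightarrow>\<^sub>E X. inj_on y {..<n}}" by (simp add: z)
  next
    fix z assume "z \<in> {y \<in> {..<n} \<rightarrow>\<^sub>E X. inj_on y {..<n}}"
    then have "z \<in> {..<n} \<rightarrow>\<^sub>E X" "inj_on z {..<n}" by auto
    then obtain p x where "p permutes {..<n}" "x \<in> incseqs n X" "z = x \<circ> p"
      by (rule permutation_of_incseq)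
    then show "z \<in> (\<lambda>(p, y). y \<circ> p) ` S"
      by (force simp: S_def)
  qed
  have "(\<Sum>y\<in>{..<n} \<rightarrow>\<^sub>E X. h y) = (\<Sum>y\<in>{y \<in> {..<n} \<rightarrow>\<^sub>E X. inj_on y {..<n}}. h y)"
    using assms(1) zero by (intro sum.mono_neutral_right) (auto simp: finite_PiE)
  also have "\<dots> = (\<Sum>(p, y)\<in>S. h (y \<circ> p))"
    unfolding img[symmetric] by (subst sum.reindex[OF inj]) (simp add: case_prod_unfold)
  also have "\<dots> = (\<Sum>(p, y)\<in>S. h y)"
    by (rule sum.cong) (auto simp: S_def perm)
  also have "\<dots> = (\<Sum>p | p permutes {..<n}. \<Sum>y\<in>incseqs n X. h y)"
    unfolding S_def by (rule sum.cartesian_product[symmetric])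
  also have "\<dots> = fact n * (\<Sum>y\<in>incseqs n X. h y)"
    by (simp add: card_permutations[of "{..<n}" n])
  finally show ?thesis .
qed

text \<open>The entries of \<open>x\<close> with odd index are kept as \<open>y\<close>. Once they
  are fixed, the others range independently over the gaps between them, so their rows can be summed
  inside the determinant.\<close>

lemma sum_alternate:
  fixes lo hi :: int and r :: "int \<Rightarrow> nat \<Rightarrow> real"
  shows "(\<Sum>x\<in>incseqs (m + m) {lo..hi}. rdet (m + m) (\<lambda>i. r (x i)))
    = (\<Sum>y\<in>incseqs m {lo..hi}. paired_det m (\<lambda>i j. \<Sum>x\<in>{lo..<y i}. r x j) (\<lambda>i. r (y i)))"
proof -
  define X where "X = {lo..hi}"
  define g where "g x = (\<lambda>i\<in>{..<m}. x (2 * i + 1))" for x :: "nat \<Rightarrow> int"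
  \<comment> \<open>The last entry has odd index and is kept, so there is no gap above it; the
    lowest gap is closed at \<open>lo\<close>.\<close>
  define W where "W y i = (if odd i then {y (i div 2)} else if i = 0 then {lo..<y 0}
      else {y (i div 2 - 1)<..<y (i div 2)})" for y :: "nat \<Rightarrow> int" and i
  have g_mem: "g x \<in> incseqs m X" if "x \<in> incseqs (m + m) X" for x
    using that incseqs_less[OF that]
    by (auto simp: g_def incseqs_def PiE_iff intro!: incseqs_less[OF that])
  have fiber: "{x \<in> incseqs (m + m) X. g x = y} = Pi\<^sub>E {..<m + m} (W y)" if y: "y \<in> incseqs m X" for y
  proof (intro equalityI subsetI)
    fix x assume "x \<in> {x \<in> incseqs (m + m) X. g x = y}"
    then have x: "x \<in> incseqs (m + m) X" and gx: "\<And>i. i < m \<Longrightarrow> y i = x (2 * i + 1)"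
      by (auto simp: g_def)
    have "x i \<in> W y i" if i: "i < m + m" for i
    proof (cases "even i")
      case False
      then obtain l where "i = 2 * l + 1" by (elim oddE)
      with i show ?thesis by (simp add: W_def gx)
    next
      case True
      then obtain l where l: "i = 2 * l" by (elim evenE)
      have "2 * l + 1 < m + m" using i l by presburger
      then have "x i < y l"
        using i l incseqs_less[OF x, of "2 * l" "2 * l + 1"] by (simp add: gx)
      moreover have "lo \<le> x i" using x i by (auto simp: incseqs_def X_def)
      moreover have "y (l - 1) < x i" if "l > 0"
        using that i l incseqs_less[OF x, of "2 * (l - 1) + 1" i] by (simp add: gx)
      ultimately show ?thesis using l by (auto simp: W_def)
    qed
    with x show "x \<in> Pi\<^sub>E {..<m + m} (W y)"
      by (auto simp: incseqs_def PiE_def)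
  next
    fix x assume x: "x \<in> Pi\<^sub>E {..<m + m} (W y)"
    have odd: "x (2 * l + 1) = y l" if "l < m" for l
      using PiE_mem[OF x, of "2 * l + 1"] that by (simp add: W_def)
    have even: "x (2 * l) < y l" "l = 0 \<Longrightarrow> lo \<le> x (2 * l)" "l > 0 \<Longrightarrow> y (l - 1) < x (2 * l)"
      if "l < m" for l
      using PiE_mem[OF x, of "2 * l"] that by (auto simp: W_def split: if_splits)
    have ylo: "lo \<le> y l" "y l \<le> hi" if "l < m" for l
      using y that by (auto simp: incseqs_def X_def)
    have "x i \<in> X \<and> (Suc i < m + m \<longrightarrow> x i < x (Suc i))" if i: "i < m + m" for i
    proof (cases "even i")
      case False
      then obtain l where l: "i = 2 * l + 1" by (elim oddE)
      with i odd[of l] ylo[of l] even(3)[of "Suc l"] show ?thesis by (simp add: X_def)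
    next
      case True
      then obtain l where l: "i = 2 * l" by (elim evenE)
      with i odd[of l] ylo[of l] even[of l] ylo[of "l - 1"] less_imp_diff_less[of l m 1] show ?thesis
        by (cases "l = 0") (auto simp: X_def)
    qed
    then have "x \<in> incseqs (m + m) X"
      using x by (auto simp: incseqs_def PiE_def)
    moreover have "g x = y"
      using y odd by (intro extensionalityI[of _ "{..<m}"]) (auto simp: g_def incseqs_def PiE_def)
    ultimately show "x \<in> {x \<in> incseqs (m + m) X. g x = y}" by simp
  qed
  have fin: "finite (W y i)" for y i by (simp add: W_def)
  define S where "S y j = (\<Sum>x\<in>{lo..<y}. r x j)" for y j
  have "(\<Sum>x\<in>incseqs (m + m) X. rdet (m + m) (\<lambda>i. r (x i)))
      = (\<Sum>y\<in>incseqs m X. \<Sum>x\<in>{x \<in> incseqs (m + m) X. g x = y}. rdet (m + m) (\<lambda>i. r (x i)))"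
    using g_mem by (intro sum.group[symmetric]) (auto simp: X_def)
  also have "\<dots> = (\<Sum>y\<in>incseqs m X. rdet (m + m) (\<lambda>i j. \<Sum>x\<in>W y i. r x j))"
    using fin by (intro sum.cong refl) (simp add: fiber rdet_row_sums)
  also have "\<dots> = (\<Sum>y\<in>incseqs m X. paired_det m (\<lambda>i. S (y i)) (\<lambda>i. r (y i)))"
  proof (intro sum.cong refl)
    fix y assume y: "y \<in> incseqs m X"
    define R where "R = (\<lambda>i. if even i then S (y (i div 2)) else r (y (i div 2)))"
    \<comment> \<open>The sum over a gap is \<open>S (y (Suc l)) - S (y l) - r (y l)\<close>, and
      the two subtracted vectors are the two rows directly above. So partial sums and gap sums give
      the same determinant.\<close>
    define a :: "nat \<Rightarrow> nat \<Rightarrow> real" where "a i l = (if even i \<and> (i = l + 2 \<or> i = l + 1) then -1 else 0)" for i l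
    have "rdet (m + m) (\<lambda>i j. \<Sum>x\<in>W y i. r x j) = rdet (m + m) (\<lambda>i j. R i j + (\<Sum>l<i. a i l * R l j))"
    proof (rule rdet_cong)
      fix i j assume i: "i < m + m"
      show "(\<Sum>x\<in>W y i. r x j) = R i j + (\<Sum>l<i. a i l * R l j)"
      proof (cases "even i \<and> i > 0")
        case False
        then show ?thesis by (auto simp: W_def R_def S_def a_def)
      next
        case True
        then have "i = 2 * Suc (i div 2 - 1)" by presburger
        then obtain l where l: "i = 2 * Suc l" by blast
        have less: "y l < y (Suc l)" using y i l by (simp add: incseqs_less)
        have "lo \<le> y l" using y i l by (auto simp: incseqs_def X_def)
        then have "{lo..<y (Suc l)} = {lo..<y l} \<union> ({y l} \<union> {y l<..<y (Suc l)})"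
          using less by auto
        moreover have disj: "{lo..<y l} \<inter> {y l<..<y (Suc l)} = {}" by auto
        ultimately have "S (y (Suc l)) j = S (y l) j + (r (y l) j + (\<Sum>x\<in>{y l<..<y (Suc l)}. r x j))"
          unfolding S_def using disj by (simp add: sum.union_disjoint)
        moreover have "(\<Sum>l'<i. a i l' * R l' j) = (\<Sum>l'\<in>{2 * l, 2 * l + 1}. a i l' * R l' j)"
          using l by (intro sum.mono_neutral_right) (auto simp: a_def)
        ultimately show ?thesis
          using l by (simp add: W_def R_def a_def)
      qed
    qed
    then show "rdet (m + m) (\<lambda>i j. \<Sum>x\<in>W y i. r x j) = paired_det m (\<lambda>i. S (y i)) (\<lambda>i. r (y i))"
      unfolding rdet_add_earlier_rows paired_det_def R_def .
  qed
  finally show ?thesis unfolding S_def X_def .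
qed

text \<open>Exchanging two pairs takes two row transpositions, so the signs cancel: as a function of
  its pairs the determinant is symmetric.\<close>

lemma paired_det_swap:
  assumes "a < m" "b < m" "a \<noteq> b"
  shows "paired_det m (U \<circ> Transposition.transpose a b) (V \<circ> Transposition.transpose a b) = paired_det m U V"
proof -
  define R where "R = (\<lambda>i. if even i then U (i div 2) else V (i div 2))"
  define p where "p = Transposition.transpose (2 * a) (2 * b)"
  define q where "q = Transposition.transpose (2 * a + 1) (2 * b + 1)"
  have pq: "p permutes {..<m + m}" "q permutes {..<m + m}"
    unfolding p_def q_def using assms by (auto intro!: permutes_swap_id)
  have "(if even i then (U \<circ> Transposition.transpose a b) (i div 2)
      else (V \<circ> Transposition.transpose a b) (i div 2)) = R (q (p i))" for i
  proof (cases "even i")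
    case True
    then obtain l where "i = 2 * l" by (elim evenE)
    then show ?thesis
      using assms by (auto simp: R_def p_def q_def Transposition.transpose_def)
  next
    case False
    then obtain l where "i = 2 * l + 1" by (elim oddE)
    moreover from this have "i \<noteq> 2 * a" "i \<noteq> 2 * b" by presburger+
    ultimately show ?thesis
      using assms by (auto simp: R_def p_def q_def Transposition.transpose_def)
  qed
  then have "paired_det m (U \<circ> Transposition.transpose a b) (V \<circ> Transposition.transpose a b)
      = rdet (m + m) (\<lambda>i. R (q (p i)))"
    unfolding paired_det_def by presburger
  also have "\<dots> = rdet (m + m) R"
    using rdet_permute_rows[OF pq(1), of "\<lambda>i. R (q i)"] rdet_permute_rows[OF pq(2), of R] assms
    by (simp add: p_def q_def sign_swap_id)
  finally show ?thesis by (simp add: paired_det_def R_def)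
qed

lemma paired_det_equal_rows:
  assumes "a < m" "b < m" "a \<noteq> b" "U a = U b"
  shows "paired_det m U V = 0"
  unfolding paired_det_def using assms
  by (intro rdet_equal_rows[of "2 * a" _ "2 * b"]) auto

lemma paired_det_cong:
  assumes "\<And>i. i < m \<Longrightarrow> U i = U' i" "\<And>i. i < m \<Longrightarrow> V i = V' i"
  shows "paired_det m U V = paired_det m U' V'"
  unfolding paired_det_def
proof (rule rdet_cong)
  fix i j assume "i < m + m"
  then have "i div 2 < m" by presburger
  then show "(if even i then U (i div 2) else V (i div 2)) j
      = (if even i then U' (i div 2) else V' (i div 2)) j"
    using assms by simp
qed

text \<open>Reflection acts on even and odd columns with opposite signs, which yields the two parts
  needed for the alternating identity. The sign \<open>s\<close> stays open because it is
  \<open>1\<close> for the functions of a central family and \<open>-1\<close> once a border column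
  has been put in front of them.\<close>

theorem sum_incseqs_rdet:
  fixes lo hi :: int and r :: "int \<Rightarrow> nat \<Rightarrow> real" and s :: real
  assumes s: "s = 1 \<or> s = -1"
    and reflect: "\<And>x j. x \<in> {lo..hi} \<Longrightarrow> r (lo + hi - x) j = (if even j then s else - s) * r x j"
  shows "fact m * (\<Sum>x\<in>incseqs (m + m) {lo..hi}. rdet (m + m) (\<lambda>i. r (x i)))
    = (\<Sum>y\<in>{..<m} \<rightarrow>\<^sub>E {lo..hi}.
        rdet m (\<lambda>i j. (\<Sum>x\<in>{lo..<y i}. r x (2 * j)) - (\<Sum>x\<in>{y i<..hi}. r x (2 * j)))
      * rdet m (\<lambda>i j. r (y i) (2 * j + 1)))"
proof -
  define S where "S y j = (\<Sum>x\<in>{lo..<y}. r x j)" for y j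
  define p where "p x j = (if even j then r x j else 0)" for x j
  define q where "q x j = (if odd j then r x j else 0)" for x j
  define d where "d y j = (\<Sum>x\<in>{lo..<y}. p x j) - (\<Sum>x\<in>{y<..hi}. p x j)" for y j
  have r: "r x = (\<lambda>j. p x j + q x j)" for x by (auto simp: p_def q_def)
  have replace: "(\<Sum>y\<in>{lo..hi}. \<alpha> (S y) (r y)) = (\<Sum>y\<in>{lo..hi}. \<alpha> (d y) (q y))" if "alternating \<alpha>" for \<alpha>
    unfolding S_def d_def r
    by (rule alternating_sum_reflect[OF that s]) (auto simp: p_def q_def reflect)
  define h where "h y = paired_det m (\<lambda>i. S (y i)) (\<lambda>i. r (y i))" for y
  have "fact m * (\<Sum>x\<in>incseqs (m + m) {lo..hi}. rdet (m + m) (\<lambda>i. r (x i)))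
      = fact m * (\<Sum>y\<in>incseqs m {lo..hi}. h y)"
    unfolding sum_alternate h_def S_def ..
  also have "\<dots> = (\<Sum>y\<in>{..<m} \<rightarrow>\<^sub>E {lo..hi}. h y)"
  proof (rule sum_symmetric[symmetric])
    show "h (y \<circ> Transposition.transpose a b) = h y" if "a < m" "b < m" "a \<noteq> b" for y a b
      using paired_det_swap[OF that, of "\<lambda>i. S (y i)" "\<lambda>i. r (y i)"] by (simp add: h_def o_def)
    show "h y = 0" if "\<not> inj_on y {..<m}" for y
    proof -
      from that obtain a b where "a < m" "b < m" "a \<noteq> b" "y a = y b"
        by (auto simp: inj_on_def)
      then show ?thesis unfolding h_def by (intro paired_det_equal_rows[of a m b]) auto
    qed
  qed simp
  \<comment> \<open>Rows with index at least \<open>m\<close> lie outside the determinant; zero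
    vectors give the sum the shape in which all \<open>m\<close> pairs can be replaced.\<close>
  also have "\<dots> = (\<Sum>y\<in>{..<m} \<rightarrow>\<^sub>E {lo..hi}. paired_det m (\<lambda>i. if i < m then S (y i) else (\<lambda>_. 0))
      (\<lambda>i. if i < m then r (y i) else (\<lambda>_. 0)))"
    unfolding h_def by (intro sum.cong refl paired_det_cong) simp_all
  also have "\<dots> = (\<Sum>y\<in>{..<m} \<rightarrow>\<^sub>E {lo..hi}. paired_det m (\<lambda>i. if i < m then d (y i) else (\<lambda>_. 0))
      (\<lambda>i. if i < m then q (y i) else (\<lambda>_. 0)))"
    by (rule sum_paired_det_replace[OF replace]) auto
  also have "\<dots> = (\<Sum>y\<in>{..<m} \<rightarrow>\<^sub>E {lo..hi}. rdet m (\<lambda>i j. d (y i) (2 * j)) * rdet m (\<lambda>i j. q (y i) (2 * j + 1)))"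
  proof (intro sum.cong refl)
    fix y :: "nat \<Rightarrow> int"
    show "paired_det m (\<lambda>i. if i < m then d (y i) else (\<lambda>_. 0)) (\<lambda>i. if i < m then q (y i) else (\<lambda>_. 0))
        = rdet m (\<lambda>i j. d (y i) (2 * j)) * rdet m (\<lambda>i j. q (y i) (2 * j + 1))"
      unfolding paired_det_def
      by (subst rdet_checkerboard)
        (auto simp: d_def p_def q_def intro!: arg_cong2[where f = "(*)"] rdet_cong)
  qed
  finally show ?thesis by (simp add: d_def p_def q_def)
qed

section \<open>Counting chains of interlacing rows\<close>

definition central_family :: "(nat \<Rightarrow> int \<Rightarrow> real) \<Rightarrow> bool" where
  "central_family f \<longleftrightarrow> (\<forall>x. f 0 x = 1) \<and>
    (\<forall>m x. f (Suc m) (x + 1) - f (Suc m) (x - 1) = f m x) \<and>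
    (\<forall>m x. f m (- x) = (-1) ^ m * f m x)"

text \<open>This is the product of \<open>x + m - 1\<close>, \<open>x + m - 3\<close>, ...,
  \<open>x - m + 1\<close> divided by \<open>2 ^ m * fact m\<close>. The factors lie symmetrically
  around \<open>x\<close>, whence the parity; the central difference is Pascal's rule.\<close>

definition central_binomial :: "nat \<Rightarrow> int \<Rightarrow> real" where
  "central_binomial m x = ((of_int x + of_nat m - 1) / 2) gchoose m"

lemma central_family_central_binomial: "central_family central_binomial"
  unfolding central_family_def
proof (intro conjI allI)
  fix m x
  show "central_binomial 0 x = 1"
    by (simp add: central_binomial_def)
  show "central_binomial (Suc m) (x + 1) - central_binomial (Suc m) (x - 1) = central_binomial m x"
    using gbinomial_Suc_Suc[of "(of_int x + of_nat m - 1) / 2 :: real" m]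
    by (simp add: central_binomial_def field_simps)
  show "central_binomial m (- x) = (-1) ^ m * central_binomial m x"
    using gbinomial_negated_upper[of "(of_int (- x) + of_nat m - 1) / 2 :: real" m]
    by (simp add: central_binomial_def field_simps)
qed

definition averaged :: "(nat \<Rightarrow> int \<Rightarrow> real) \<Rightarrow> nat \<Rightarrow> int \<Rightarrow> real" where
  "averaged f m x = (f m (x + 1) + f m (x - 1)) / 2"

lemma central_family_0: "central_family f \<Longrightarrow> f 0 x = 1"
  by (simp add: central_family_def)

lemma central_family_diff: "central_family f \<Longrightarrow> f m x = f (Suc m) (x + 1) - f (Suc m) (x - 1)"
  by (simp add: central_family_def)

lemma central_family_minus: "central_family f \<Longrightarrow> f m (- x) = (-1) ^ m * f m x"
  unfolding central_family_def by blast

text \<open>Averaging over the two neighbours commutes with central differences and with reflection,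
  and it fixes constants.\<close>

lemma central_family_averaged:
  assumes f: "central_family f"
  shows "central_family (averaged f)"
  unfolding central_family_def
proof (intro conjI allI)
  fix m x
  show "averaged f 0 x = 1"
    by (simp add: averaged_def central_family_0[OF f])
  show "averaged f (Suc m) (x + 1) - averaged f (Suc m) (x - 1) = averaged f m x"
    using central_family_diff[OF f, of m "x + 1"] central_family_diff[OF f, of m "x - 1"]
    by (simp add: averaged_def field_simps)
  have "- x + 1 = - (x - 1)" "- x - 1 = - (x + 1)" by simp_all
  then have "f m (- x + 1) = (-1) ^ m * f m (x - 1)" "f m (- x - 1) = (-1) ^ m * f m (x + 1)"
    by (simp_all only: central_family_minus[OF f])
  then show "averaged f m (- x) = (-1) ^ m * averaged f m x"
    by (simp add: averaged_def distrib_left add.commute)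
qed

text \<open>Telescoping in steps of two. The empty range \<open>u = l - 1\<close> is included
  because one of the sums on the two sides of \<open>y\<close> is empty when \<open>y\<close> is an
  end of the interval.\<close>

lemma central_family_sum:
  fixes l u a :: int
  assumes f: "central_family f" and "l \<le> u + 1"
  shows "(\<Sum>\<mu>\<in>{l..u}. f m (2 * \<mu> + a)) = f (Suc m) (2 * u + a + 1) - f (Suc m) (2 * l + a - 1)"
  using assms(2)
proof (induction "nat (u + 1 - l)" arbitrary: u)
  case 0
  then have u: "u = l - 1" by simp
  show ?case unfolding u by (simp add: algebra_simps)
next
  case (Suc k)
  have "{l..u} = insert u {l..u - 1}" using Suc(2) by auto
  moreover have "(\<Sum>\<mu>\<in>{l..u - 1}. f m (2 * \<mu> + a))
      = f (Suc m) (2 * (u - 1) + a + 1) - f (Suc m) (2 * l + a - 1)"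
    by (rule Suc(1)) (use Suc(2) in auto)
  ultimately show ?case
    using central_family_diff[OF f, of m "2 * u + a"] by (simp add: algebra_simps)
qed

section \<open>Chains of rows below a prescribed last row\<close>

type_synonym row = "nat \<Rightarrow> int"

primrec chain_count :: "(nat \<Rightarrow> row \<Rightarrow> row set) \<Rightarrow> nat \<Rightarrow> row \<Rightarrow> nat" where
  "chain_count S 0 x = 1"
| "chain_count S (Suc t) x = (\<Sum>y\<in>S t x. chain_count S t y)"

text \<open>\<open>S s\<close> maps a row at level \<open>s + 1\<close> to the rows admissible at
  level \<open>s\<close>. Fixing the value \<open>undefined\<close> above level \<open>t\<close>
  makes each chain a single function, so that \<open>card\<close> counts chains.\<close>

definition row_chains :: "(nat \<Rightarrow> row \<Rightarrow> row set) \<Rightarrow> nat \<Rightarrow> row \<Rightarrow> (nat \<Rightarrow> row) set" where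
  "row_chains S t x = {g. g t = x \<and> (\<forall>s<t. g s \<in> S s (g (Suc s))) \<and> (\<forall>s>t. g s = undefined)}"

lemma row_chains_0: "row_chains S 0 x = {(\<lambda>_. undefined)(0 := x)}"
  by (auto simp: row_chains_def fun_eq_iff)

lemma row_chains_Suc: "row_chains S (Suc t) x = (\<Union>y\<in>S t x. (\<lambda>g. g(Suc t := x)) ` row_chains S t y)"
proof (intro equalityI subsetI)
  fix g assume g: "g \<in> row_chains S (Suc t) x"
  then have "g(Suc t := undefined) \<in> row_chains S t (g t)"
    by (auto simp: row_chains_def)
  moreover have "g = (g(Suc t := undefined))(Suc t := x)"
    using g by (auto simp: row_chains_def)
  moreover have "g t \<in> S t x"
    using g by (auto simp: row_chains_def)
  ultimately show "g \<in> (\<Union>y\<in>S t x. (\<lambda>g. g(Suc t := x)) ` row_chains S t y)"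
    by blast
next
  fix g assume "g \<in> (\<Union>y\<in>S t x. (\<lambda>g. g(Suc t := x)) ` row_chains S t y)"
  then show "g \<in> row_chains S (Suc t) x"
    by (auto simp: row_chains_def less_Suc_eq)
qed

lemma card_row_chains:
  assumes "\<And>t x. finite (S t x)"
  shows "finite (row_chains S t x) \<and> card (row_chains S t x) = chain_count S t x"
proof (induction t arbitrary: x)
  case 0
  then show ?case by (simp add: row_chains_0)
next
  case (Suc t)
  have inj: "inj_on (\<lambda>g. g(Suc t := x)) (row_chains S t y)" for y
  proof (rule inj_onI)
    fix g h assume "g \<in> row_chains S t y" "h \<in> row_chains S t y" "g(Suc t := x) = h(Suc t := x)"
    then show "g = h"
      unfolding row_chains_def by (intro ext) (metis (mono_tags, lifting) fun_upd_apply lessI mem_Collect_eq)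
  qed
  have disj: "(\<lambda>g. g(Suc t := x)) ` row_chains S t y \<inter> (\<lambda>g. g(Suc t := x)) ` row_chains S t z = {}"
    if "y \<noteq> z" for y z
  proof -
    have "h t = y" if "h \<in> (\<lambda>g. g(Suc t := x)) ` row_chains S t y" for h y
      using that by (auto simp: row_chains_def)
    with that show ?thesis by blast
  qed
  show ?case
    unfolding row_chains_Suc using Suc assms disj
    by (subst card_UN_disjoint) (auto simp: card_image[OF inj])
qed

definition gt_rows :: "nat \<Rightarrow> row \<Rightarrow> row set" where
  "gt_rows t x = (\<Pi>\<^sub>E i\<in>{..<Suc t}. {x i..x (Suc i)})"

lemma finite_gt_rows: "finite (gt_rows t x)"
  unfolding gt_rows_def by (simp add: finite_PiE)

text \<open>Neighbouring intervals share an end point of \<open>x\<close>. The shift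
  \<open>2 * int i - int t\<close> gives the telescoped upper end of one interval and the lower end
  of the next the same argument, so differences of consecutive rows appear and a constant column
  restores the full size. The offset \<open>a\<close> is carried along unchanged; it later centres
  the entries at \<open>c / 2\<close>.\<close>

lemma gt_chain_count:
  assumes f: "central_family f" and "\<And>i. i < t \<Longrightarrow> x i \<le> x (Suc i)"
  shows "real (chain_count gt_rows t x) = rdet (Suc t) (\<lambda>i j. f j (2 * x i + (2 * int i - int t + a)))"
  using assms(2)
proof (induction t arbitrary: x)
  case 0
  then show ?case by (simp add: central_family_0[OF f])
next
  case (Suc t)
  have "real (chain_count gt_rows (Suc t) x)
      = (\<Sum>y\<in>gt_rows t x. rdet (Suc t) (\<lambda>i j. f j (2 * y i + (2 * int i - int t + a))))"
  proof -
    have y: "x l \<le> y l" "y l \<le> x (Suc l)" if "y \<in> gt_rows t x" "l < Suc t" for y l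
      using that PiE_mem[of y "{..<Suc t}" "\<lambda>i. {x i..x (Suc i)}" l] by (simp_all add: gt_rows_def)
    have "y i \<le> y (Suc i)" if "y \<in> gt_rows t x" "i < t" for y i
      using y(2)[of y i] y(1)[of y "Suc i"] that by simp
    then show ?thesis by (simp add: Suc.IH)
  qed
  also have "\<dots> = rdet (Suc t) (\<lambda>i j. \<Sum>\<mu>\<in>{x i..x (Suc i)}. f j (2 * \<mu> + (2 * int i - int t + a)))"
    unfolding gt_rows_def by (rule rdet_row_sums[symmetric]) simp
  also have "\<dots> = rdet (Suc t) (\<lambda>i j. f (Suc j) (2 * x (Suc i) + (2 * int (Suc i) - int (Suc t) + a))
      - f (Suc j) (2 * x i + (2 * int i - int (Suc t) + a)))"
  proof (rule rdet_cong)
    fix i j assume "i < Suc t"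
    then have "x i \<le> x (Suc i) + 1" using Suc.prems[of i] by simp
    from central_family_sum[OF f this, of j "2 * int i - int t + a"]
    show "(\<Sum>\<mu>\<in>{x i..x (Suc i)}. f j (2 * \<mu> + (2 * int i - int t + a)))
        = f (Suc j) (2 * x (Suc i) + (2 * int (Suc i) - int (Suc t) + a))
          - f (Suc j) (2 * x i + (2 * int i - int (Suc t) + a))"
      by (simp add: algebra_simps)
  qed
  also have "\<dots> = rdet (Suc (Suc t)) (\<lambda>i j. f j (2 * x i + (2 * int i - int (Suc t) + a)))"
    by (rule rdet_const_col0[symmetric]) (simp add: central_family_0[OF f])
  finally show ?case .
qed

text \<open>
  For even \<open>t\<close> the entry with index \<open>0\<close> lies on the antidiagonal: it is only required to be at most as far
  from \<open>c / 2\<close> as its neighbours. After centring at \<open>c / 2\<close> it is the signed entry of an orthogonal pattern.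
\<close>

definition qt_rows :: "int \<Rightarrow> nat \<Rightarrow> row \<Rightarrow> row set" where
  "qt_rows c t x = (\<Pi>\<^sub>E i\<in>{..<Suc (t div 2)}.
     if odd t then {(if i = 0 then max (x 0) (c - x 0) else x i)..x (Suc i)}
     else {(if i = 0 then c - x 0 else x (i - 1))..x i})"

text \<open>For \<open>t > 0\<close> these inequalities say exactly that all intervals in
  \<open>qt_rows c (t - 1) x\<close> are nonempty.\<close>

definition qt_top :: "int \<Rightarrow> nat \<Rightarrow> row \<Rightarrow> bool" where
  "qt_top c t x \<longleftrightarrow> (\<forall>i<t div 2. x i \<le> x (Suc i)) \<and> (odd t \<longrightarrow> c \<le> 2 * x 0) \<and>
     (even t \<and> t > 0 \<longrightarrow> c - x 0 \<le> x 1)"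

lemma finite_qt_rows: "finite (qt_rows c t x)"
  unfolding qt_rows_def by (intro finite_PiE) auto

lemma qt_rows_top:
  assumes "qt_top c (Suc t) x" "y \<in> qt_rows c t x"
  shows "qt_top c t y"
proof (cases "odd t")
  case True
  have y: "(if i = 0 then max (x 0) (c - x 0) else x i) \<le> y i" "y i \<le> x (Suc i)" if "i \<le> t div 2" for i
    using PiE_mem[OF assms(2)[unfolded qt_rows_def], of i] that True by auto
  have "y i \<le> y (Suc i)" if "i < t div 2" for i
    using y(2)[of i] y(1)[of "Suc i"] that by simp
  moreover have "c \<le> 2 * y 0"
    using y(1)[of 0] by simp
  ultimately show ?thesis using True by (simp add: qt_top_def)
next
  case False
  have y: "(if i = 0 then c - x 0 else x (i - 1)) \<le> y i" "y i \<le> x i" if "i \<le> t div 2" for i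
    using PiE_mem[OF assms(2)[unfolded qt_rows_def], of i] that False by auto
  have "y i \<le> y (Suc i)" if "i < t div 2" for i
    using y(2)[of i] y(1)[of "Suc i"] that by simp
  moreover have "c - y 0 \<le> y 1" if "t > 0"
    using y(1)[of 0] y(1)[of 1] that False by (auto elim!: evenE)
  ultimately show ?thesis using False by (simp add: qt_top_def)
qed

text \<open>Parity absorbs the boundary. A step to an even level sums odd functions into even ones,
  which take the same value at the folded lower end \<open>c - x 0\<close> as at \<open>x 0\<close>;
  the determinant gains a row. A step to an odd level sums even functions over an interval symmetric
  about \<open>c / 2\<close>, which doubles the first row and keeps the size. The power of two
  counts the steps of the second kind.\<close>

lemma qt_chain_count:
  assumes f: "central_family f" and "qt_top c t x"
  shows "real (chain_count (qt_rows c) t x) = 2 ^ (Suc t div 2) *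
    rdet (Suc (t div 2)) (\<lambda>i j. f (2 * j + t mod 2) (2 * x i + (2 * int i + int (t mod 2) - c)))"
  using assms(2)
proof (induction t arbitrary: x)
  case 0
  then show ?case by (simp add: central_family_0[OF f])
next
  case (Suc t)
  define u where "u = t div 2"
  define A where "A i j = f (2 * j + Suc t mod 2) (2 * x i + (2 * int i + int (Suc t mod 2) - c))" for i j
  define Z where "Z i = (if odd t then {(if i = 0 then max (x 0) (c - x 0) else x i)..x (Suc i)}
     else {(if i = 0 then c - x 0 else x (i - 1))..x i})" for i
  have mono: "x i \<le> x (Suc i)" if "i < Suc t div 2" for i
    using Suc.prems that by (simp add: qt_top_def)
  have "real (chain_count (qt_rows c) (Suc t) x) = (\<Sum>y\<in>Pi\<^sub>E {..<Suc u} Z. 2 ^ (Suc t div 2) *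
      rdet (Suc u) (\<lambda>i j. f (2 * j + t mod 2) (2 * y i + (2 * int i + int (t mod 2) - c))))"
    proof -
    have rows: "qt_rows c t x = Pi\<^sub>E {..<Suc u} Z"
      by (simp add: qt_rows_def Z_def[abs_def] u_def)
    show ?thesis
      unfolding rows[symmetric] unfolding u_def
      using qt_rows_top[OF Suc.prems] Suc.IH by simp
  qed
  also have "\<dots> = 2 ^ (Suc t div 2) *
      rdet (Suc u) (\<lambda>i j. \<Sum>\<mu>\<in>Z i. f (2 * j + t mod 2) (2 * \<mu> + (2 * int i + int (t mod 2) - c)))"
    unfolding sum_distrib_left[symmetric]
    by (subst rdet_row_sums[symmetric]) (auto simp: Z_def)
  also have "\<dots> = 2 ^ (Suc (Suc t) div 2) * rdet (Suc (Suc t div 2)) A"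
  proof (cases "odd t")
    case True
    then obtain v where t: "t = 2 * v + 1" by (elim oddE)
    have tm: "t mod 2 = 1" "Suc t mod 2 = 0" using True by presburger+
    have "rdet (Suc u) (\<lambda>i j. \<Sum>\<mu>\<in>Z i. f (2 * j + t mod 2) (2 * \<mu> + (2 * int i + int (t mod 2) - c)))
        = rdet (Suc u) (\<lambda>i j. A (Suc i) (Suc j) - A i (Suc j))"
    proof (rule rdet_cong)
      fix i j assume i: "i < Suc u"
      define l where "l = (if i = 0 then max (x 0) (c - x 0) else x i)"
      have "l \<le> x (Suc i) + 1"
        using Suc.prems mono[of i] i t by (auto simp: l_def qt_top_def u_def)
      note sum = central_family_sum[OF f this, of "2 * j + 1" "2 * int i + 1 - c"]
      have "f (2 * j + 2) (2 * l + (2 * int i - c)) = f (2 * j + 2) (2 * x i + (2 * int i - c))"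
      proof (cases "i = 0 \<and> l = c - x 0")
        case True
        then have "2 * l + (2 * int i - c) = - (2 * x i + (2 * int i - c))" by simp
        then show ?thesis by (simp only: central_family_minus[OF f]) simp
      next
        case False
        then have "l = x i" by (auto simp: l_def max_def)
        then show ?thesis by simp
      qed
      with sum show "(\<Sum>\<mu>\<in>Z i. f (2 * j + t mod 2) (2 * \<mu> + (2 * int i + int (t mod 2) - c)))
          = A (Suc i) (Suc j) - A i (Suc j)"
        using True by (simp add: Z_def tm A_def l_def[symmetric] algebra_simps)
    qed
    also have "\<dots> = rdet (Suc (Suc u)) A"
      by (rule rdet_const_col0[symmetric]) (simp add: A_def tm central_family_0[OF f])
    finally show ?thesis by (simp add: u_def t)
  next
    case False
    then obtain v where t: "t = 2 * v" by auto
    have tm: "t mod 2 = 0" "Suc t mod 2 = 1" using False by presburger+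
    have "rdet (Suc u) (\<lambda>i j. \<Sum>\<mu>\<in>Z i. f (2 * j + t mod 2) (2 * \<mu> + (2 * int i + int (t mod 2) - c)))
        = rdet (Suc u) (\<lambda>i j. (if i = 0 then 2 else 1) * (if i = 0 then A i j else A i j - A (i - 1) j))"
    proof (rule rdet_cong)
      fix i j assume i: "i < Suc u"
      show "(\<Sum>\<mu>\<in>Z i. f (2 * j + t mod 2) (2 * \<mu> + (2 * int i + int (t mod 2) - c)))
        = (if i = 0 then 2 else 1) * (if i = 0 then A i j else A i j - A (i - 1) j)"
      proof (cases i)
        case 0
        have "c - x 0 \<le> x 0 + 1" using Suc.prems t by (simp add: qt_top_def)
        from central_family_sum[OF f this, of "2 * j" "- c"]
          central_family_minus[OF f, of "Suc (2 * j)" "2 * x 0 + 1 - c"] 0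
        show ?thesis using False by (simp add: Z_def tm A_def algebra_simps)
      next
        case (Suc i')
        have "x i' \<le> x i + 1" using mono[of i'] i Suc t by (simp add: u_def)
        from central_family_sum[OF f this, of "2 * j" "2 * int i - c"] Suc
        show ?thesis using False by (simp add: Z_def tm A_def algebra_simps)
      qed
    qed
    also have "\<dots> = (\<Prod>i<Suc u. if i = 0 then 2 else 1) * rdet (Suc u) A"
      by (simp only: rdet_scale_rows rdet_row_differences)
    also have "(\<Prod>i<Suc u. if i = 0 then 2 else 1) = (2 :: real)"
      by (simp add: prod.lessThan_Suc_shift)
    finally show ?thesis by (simp add: u_def t)
  qed
  finally show ?case unfolding A_def .
qed

section \<open>Sums of products of determinants\<close>

text \<open>
  Two half-weighted end points with opposite signs reduce an odd number of variables to the even case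
  and keep the reflection symmetry of \<open>r\<close>.
\<close>

lemma sum_incseqs_border:
  fixes lo hi :: int and r :: "int \<Rightarrow> nat \<Rightarrow> real"
  assumes "odd n" "lo < hi"
    and lo: "\<And>j. r lo j = (if j = 0 then 1 / 2 else 0)"
    and hi: "\<And>j. r hi j = (if j = 0 then - 1 / 2 else 0)"
    and inner: "\<And>x. lo < x \<Longrightarrow> x < hi \<Longrightarrow> r x 0 = 0"
  shows "(\<Sum>x\<in>incseqs (Suc n) {lo..hi}. rdet (Suc n) (\<lambda>i. r (x i)))
    = (\<Sum>x\<in>incseqs n {lo<..<hi}. rdet n (\<lambda>i j. r (x i) (Suc j)))"
proof -
  define S where "S = incseqs (Suc n) {lo..hi}"
  define T where "T = incseqs n {lo<..<hi}"
  define F where "F x = rdet (Suc n) (\<lambda>i. r (x i))" for x :: "nat \<Rightarrow> int"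
  define G where "G x = rdet n (\<lambda>i j. r (x i) (Suc j))" for x :: "nat \<Rightarrow> int"
  \<comment> \<open>\<open>A\<close> and \<open>B\<close> collect the sequences that contain exactly
    one border point. With both, the last row has only its first entry and becomes zero when the
    first row and column are removed; with neither, the first column is zero.\<close>
  define A where "A = {x \<in> S. x 0 = lo \<and> x n \<noteq> hi}"
  define B where "B = {x \<in> S. x 0 \<noteq> lo \<and> x n = hi}"
  have "n > 0" using \<open>odd n\<close> by (cases n) auto
  have fin: "finite S" by (simp add: S_def)
  have less: "x i < x j" if "x \<in> S" "i < j" "j \<le> n" for x i j
    using that by (intro incseqs_less[of x "Suc n"]) (auto simp: S_def)
  have mem: "lo \<le> x i" "x i \<le> hi" if "x \<in> S" "i \<le> n" for x i
    using that by (auto simp: S_def incseqs_def PiE_iff)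
  have mem': "lo < x i" "x i < hi" if "x \<in> T" "i < n" for x i
    using that by (auto simp: T_def incseqs_def PiE_iff)
  have FA: "F x = 1 / 2 * rdet n (\<lambda>i j. r (x (Suc i)) (Suc j))" if "x 0 = lo" for x
    unfolding F_def by (subst rdet_first_row_unit) (simp_all add: lo that)
  \<comment> \<open>As \<open>n\<close> is odd, the cofactor sign is \<open>-1\<close> and meets the
    entry \<open>- 1 / 2\<close>. Both classes thus contribute one half with the same sign.\<close>
  have FB: "F x = 1 / 2 * G x" if "x n = hi" for x
    unfolding F_def G_def using \<open>odd n\<close> by (subst rdet_last_row_unit) (simp_all add: hi that)
  have zero: "F x = 0" if "x \<in> S - (A \<union> B)" for x
  proof (cases "x 0 = lo")
    case True
    with that have "x n = hi" by (auto simp: A_def)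
    then have "rdet n (\<lambda>i j. r (x (Suc i)) (Suc j)) = 0"
      using \<open>n > 0\<close> by (intro rdet_zero_row[of "n - 1"]) (simp_all add: hi)
    then show ?thesis by (simp add: FA[of x] True)
  next
    case False
    with that have x: "x \<in> S" "x 0 \<noteq> lo" "x n \<noteq> hi" by (auto simp: B_def)
    have "lo < x i \<and> x i < hi" if "i < Suc n" for i
    proof -
      have "x 0 \<le> x i" using less[OF x(1), of 0 i] that by (cases "i = 0") auto
      moreover have "x i \<le> x n" using less[OF x(1), of i n] that by (cases "i = n") auto
      ultimately show ?thesis using x mem[OF x(1), of 0] mem[OF x(1), of n] by auto
    qed
    then have "rdet (Suc n) (\<lambda>i j. r (x j) i) = 0"
      by (intro rdet_zero_row[of 0]) (auto intro: inner)
    then show ?thesis using rdet_transpose[of "Suc n" "\<lambda>i. r (x i)"] by (simp add: F_def)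
  qed
  have sumA: "(\<Sum>x\<in>A. F x) = (\<Sum>x\<in>T. 1 / 2 * G x)"
  proof (rule sum.reindex_bij_witness[of _ "\<lambda>y. \<lambda>i\<in>{..<Suc n}. if i = 0 then lo else y (i - 1)"
        "\<lambda>x. \<lambda>i\<in>{..<n}. x (Suc i)"])
    fix x assume "x \<in> A"
    then have x: "x \<in> S" "x 0 = lo" "x n \<noteq> hi" by (auto simp: A_def)
    have "x i = undefined" if "i \<ge> Suc n" for i
      using x that by (auto simp: S_def incseqs_def PiE_iff extensional_def)
    then show "(\<lambda>i\<in>{..<Suc n}. if i = 0 then lo else (\<lambda>i\<in>{..<n}. x (Suc i)) (i - 1)) = x"
      using x by (auto simp: fun_eq_iff)
    have "lo < x (Suc i)" if "i < n" for i using less[OF x(1), of 0 "Suc i"] x that by simp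
    moreover have "x (Suc i) < hi" if "i < n" for i
      using less[OF x(1), of "Suc i" n] x mem[OF x(1), of n] that by (cases "Suc i = n") auto
    moreover have "x (Suc i) < x (Suc (Suc i))" if "Suc i < n" for i
      using less[OF x(1)] that by simp
    ultimately show "(\<lambda>i\<in>{..<n}. x (Suc i)) \<in> T"
      by (auto simp: T_def incseqs_def)
    show "1 / 2 * G (\<lambda>i\<in>{..<n}. x (Suc i)) = F x"
      unfolding FA[of x, OF x(2)] G_def by (intro arg_cong[where f = "\<lambda>x. 1 / 2 * x"] rdet_cong) simp
  next
    fix y assume y: "y \<in> T"
    have "y i = undefined" if "i \<ge> n" for i
      using y that by (auto simp: T_def incseqs_def PiE_iff extensional_def)
    then show "(\<lambda>i\<in>{..<n}. (\<lambda>i\<in>{..<Suc n}. if i = 0 then lo else y (i - 1)) (Suc i)) = y"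
      by (auto simp: fun_eq_iff)
    have "y i < y (Suc i)" if "Suc i < n" for i
      using y that by (auto simp: T_def incseqs_def)
    then have "y (i - 1) < y i" if "i < n" "i > 0" for i
      using that by (cases i) auto
    moreover have ne: "y (n - 1) \<noteq> hi"
      using mem'(2)[OF y, of "n - 1"] \<open>n > 0\<close> by simp
    ultimately show "(\<lambda>i\<in>{..<Suc n}. if i = 0 then lo else y (i - 1)) \<in> A"
      using mem'[OF y] ne \<open>n > 0\<close> \<open>lo < hi\<close>
      by (auto simp: A_def S_def incseqs_def less_imp_le)
  qed
  have sumB: "(\<Sum>x\<in>B. F x) = (\<Sum>x\<in>T. 1 / 2 * G x)"
  proof (rule sum.reindex_bij_witness[of _ "\<lambda>y. y(n := hi)" "\<lambda>x. restrict x {..<n}"])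
    fix x assume "x \<in> B"
    then have x: "x \<in> S" "x 0 \<noteq> lo" "x n = hi" by (auto simp: B_def)
    have "x i = undefined" if "i \<ge> Suc n" for i
      using x that by (auto simp: S_def incseqs_def PiE_iff extensional_def)
    then show "(restrict x {..<n})(n := hi) = x"
      using x by (auto simp: fun_eq_iff restrict_def)
    have "x i < hi" if "i < n" for i using less[OF x(1), of i n] x that by simp
    moreover have "lo < x i" if "i < n" for i
      using less[OF x(1), of 0 i] x mem[OF x(1), of 0] that by (cases "i = 0") auto
    moreover have "x i < x (Suc i)" if "Suc i < n" for i
      using less[OF x(1)] that by simp
    ultimately show "restrict x {..<n} \<in> T"
      by (auto simp: T_def incseqs_def)
    show "1 / 2 * G (restrict x {..<n}) = F x"
      unfolding FB[of x, OF x(3)] G_def by (intro arg_cong[where f = "\<lambda>x. 1 / 2 * x"] rdet_cong) simp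
  next
    fix y assume y: "y \<in> T"
    have "y i = undefined" if "i \<ge> n" for i
      using y that by (auto simp: T_def incseqs_def PiE_iff extensional_def)
    then show "restrict (y(n := hi)) {..<n} = y"
      by (auto simp: fun_eq_iff restrict_def)
    have "y i < y (Suc i)" if "Suc i < n" for i
      using y that by (auto simp: T_def incseqs_def)
    moreover have "y(n := hi) \<in> {..<Suc n} \<rightarrow>\<^sub>E {lo..hi}"
      using y mem'[OF y] \<open>lo < hi\<close>
      by (auto simp: T_def incseqs_def PiE_iff extensional_def less_Suc_eq less_imp_le)
    ultimately show "y(n := hi) \<in> B"
      using mem'[OF y] \<open>n > 0\<close>
      by (auto simp: B_def S_def incseqs_def less_Suc_eq)
  qed
  have "(\<Sum>x\<in>S. F x) = (\<Sum>x\<in>A \<union> B. F x)"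
    using fin zero by (intro sum.mono_neutral_right) (auto simp: A_def B_def)
  also have "\<dots> = (\<Sum>x\<in>A. F x) + (\<Sum>x\<in>B. F x)"
    using fin by (intro sum.union_disjoint) (auto simp: A_def B_def)
  also have "\<dots> = (\<Sum>x\<in>T. G x)"
    unfolding sumA sumB by (simp add: sum_divide_distrib[symmetric])
  finally show ?thesis unfolding S_def T_def F_def G_def .
qed

section \<open>Folding sums at the midpoint\<close>

definition half_interval :: "int \<Rightarrow> int set" where
  "half_interval N = {x \<in> {0..N}. N \<le> 2 * x}"

definition mirror_weight :: "int \<Rightarrow> int \<Rightarrow> real" where
  "mirror_weight N x = (if 2 * x = N then 1 else 2)"

lemma finite_half_interval [simp]: "finite (half_interval N)"
  by (rule finite_subset[of _ "{0..N}"]) (auto simp: half_interval_def)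

lemma sum_mirror:
  fixes g :: "int \<Rightarrow> real"
  assumes "\<And>x. g (N - x) = g x"
  shows "(\<Sum>x\<in>{0..N}. g x) = (\<Sum>x\<in>half_interval N. mirror_weight N x * g x)"
proof -
  define A where "A = {x \<in> {0..N}. N < 2 * x}"
  define B where "B = {x \<in> {0..N}. 2 * x < N}"
  define C where "C = {x \<in> {0..N}. 2 * x = N}"
  have fin: "finite A" "finite B" "finite C"
    by (auto simp: A_def B_def C_def intro!: finite_subset[of _ "{0..N}"])
  have disj: "A \<inter> B = {}" "(A \<union> B) \<inter> C = {}" "A \<inter> C = {}" by (auto simp: A_def B_def C_def)
  have BA: "sum g B = sum g A"
    by (rule sum.reindex_bij_witness[of _ "\<lambda>x. N - x" "\<lambda>x. N - x"]) (auto simp: A_def B_def assms)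
  have "{0..N} = A \<union> B \<union> C" by (auto simp: A_def B_def C_def)
  then have "sum g {0..N} = sum g A + sum g B + sum g C"
    using fin disj by (simp add: sum.union_disjoint)
  also have "\<dots> = (\<Sum>x\<in>A. mirror_weight N x * g x) + (\<Sum>x\<in>C. mirror_weight N x * g x)"
    unfolding BA by (simp add: mirror_weight_def A_def C_def sum_distrib_left[symmetric])
  also have "\<dots> = (\<Sum>x\<in>A \<union> C. mirror_weight N x * g x)"
    using fin disj by (simp add: sum.union_disjoint)
  also have "A \<union> C = half_interval N"
    by (auto simp: A_def C_def half_interval_def)
  finally show ?thesis .
qed

lemma sum_PiE_mirror:
  fixes h :: "(nat \<Rightarrow> int) \<Rightarrow> real"
  assumes "\<And>y i. i < k \<Longrightarrow> h (y(i := N - y i)) = h y"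
  shows "(\<Sum>y\<in>{..<k} \<rightarrow>\<^sub>E {0..N}. h y)
    = (\<Sum>y\<in>{..<k} \<rightarrow>\<^sub>E half_interval N. (\<Prod>i<k. mirror_weight N (y i)) * h y)"
  using assms
proof (induction k arbitrary: h)
  case 0
  then show ?case by simp
next
  case (Suc k)
  have *: "(\<Sum>y\<in>{..<k} \<rightarrow>\<^sub>E {0..N}. h (y(k := z)))
    = (\<Sum>y\<in>{..<k} \<rightarrow>\<^sub>E half_interval N. (\<Prod>i<k. mirror_weight N (y i)) * h (y(k := z)))" for z
  proof (rule Suc.IH)
    fix y i assume "i < k"
    then have eq: "(y(i := N - y i))(k := z) = (y(k := z))(i := N - (y(k := z)) i)"
      by auto
    show "h ((y(i := N - y i))(k := z)) = h (y(k := z))"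
      unfolding eq by (rule Suc.prems) (use \<open>i < k\<close> in simp)
  qed
  have flip: "h (y(k := N - z)) = h (y(k := z))" for y z
    using Suc.prems[OF lessI, of "y(k := z)"] by (simp only: fun_upd_upd fun_upd_same)
  have "(\<Sum>y\<in>{..<Suc k} \<rightarrow>\<^sub>E {0..N}. h y)
      = (\<Sum>y\<in>{..<k} \<rightarrow>\<^sub>E half_interval N. \<Sum>z\<in>{0..N}. (\<Prod>i<k. mirror_weight N (y i)) * h (y(k := z)))"
    unfolding sum_PiE_lessThan_Suc * by (rule sum.swap)
  also have "\<dots> = (\<Sum>y\<in>{..<k} \<rightarrow>\<^sub>E half_interval N. \<Sum>z\<in>half_interval N.
      mirror_weight N z * ((\<Prod>i<k. mirror_weight N (y i)) * h (y(k := z))))"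
    by (intro sum.cong refl sum_mirror) (simp add: flip)
  also have "\<dots> = (\<Sum>z\<in>half_interval N. \<Sum>y\<in>{..<k} \<rightarrow>\<^sub>E half_interval N.
      (\<Prod>i<Suc k. mirror_weight N ((y(k := z)) i)) * h (y(k := z)))"
    by (subst sum.swap) (simp add: mult_ac)
  also have "\<dots> = (\<Sum>y\<in>{..<Suc k} \<rightarrow>\<^sub>E half_interval N. (\<Prod>i<Suc k. mirror_weight N (y i)) * h y)"
    unfolding sum_PiE_lessThan_Suc ..
  finally show ?case .
qed

section \<open>Products of two determinants\<close>

definition det_product :: "(nat \<Rightarrow> int \<Rightarrow> real) \<Rightarrow> nat \<Rightarrow> nat \<Rightarrow> int \<Rightarrow> (nat \<Rightarrow> int) \<Rightarrow> real" where
  "det_product f m e N y = rdet m (\<lambda>i j. averaged f (2 * j + e) (2 * y i - N))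
    * rdet m (\<lambda>i j. f (2 * j + e) (2 * y i - N))"

text \<open>These are the shifted last rows of the orthogonal patterns. For odd \<open>k\<close> all
  entries lie above \<open>N / 2\<close>. For even \<open>k > 0\<close> the first entry may lie on
  either side, but strictly closer to \<open>N / 2\<close> than the second.\<close>

definition mirror_domain :: "nat \<Rightarrow> int \<Rightarrow> (nat \<Rightarrow> int) set" where
  "mirror_domain k N = {y \<in> incseqs (Suc (k div 2)) {0..N}.
     if odd k then N < 2 * y 0 else k > 0 \<longrightarrow> N < y 0 + y 1}"

context
  fixes f assumes f: "central_family f"
begin

lemma rdet_central_mirror:
  assumes g: "central_family g" and "k < m"
  shows "rdet m (\<lambda>i j. g (2 * j + e) (2 * (y(k := N - y k)) i - N))
    = (-1) ^ e * rdet m (\<lambda>i j. g (2 * j + e) (2 * y i - N))"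
proof -
  have "2 * (N - y k) - N = - (2 * y k - N)" by simp
  then have "g (2 * j + e) (2 * (y(k := N - y k)) i - N)
      = (if i = k then (-1) ^ e else 1) * g (2 * j + e) (2 * y i - N)" for i j
    using central_family_minus[OF g, of "2 * j + e" "2 * y k - N"] by (simp add: power_add power_mult)
  then have "rdet m (\<lambda>i j. g (2 * j + e) (2 * (y(k := N - y k)) i - N))
      = (\<Prod>i<m. if i = k then (-1) ^ e else 1) * rdet m (\<lambda>i j. g (2 * j + e) (2 * y i - N))"
    by (simp only: rdet_scale_rows)
  then show ?thesis using \<open>k < m\<close> by (simp add: prod.delta)
qed

text \<open>Reflecting one entry scales its row by \<open>(-1) ^ e\<close> in both factors, so the
  product is unchanged.\<close>

lemma det_product_mirror:
  assumes "k < m"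
  shows "det_product f m e N (y(k := N - y k)) = det_product f m e N y"
  unfolding det_product_def rdet_central_mirror[OF f assms]
    rdet_central_mirror[OF central_family_averaged[OF f] assms]
  by (cases "even e") simp_all

lemma sum_det_product:
  "(\<Sum>y\<in>{..<m} \<rightarrow>\<^sub>E {0..N}. det_product f m e N y)
    = fact m * (\<Sum>y\<in>incseqs m (half_interval N). (\<Prod>i<m. mirror_weight N (y i)) * det_product f m e N y)"
proof -
  have "(\<Sum>y\<in>{..<m} \<rightarrow>\<^sub>E {0..N}. det_product f m e N y)
      = (\<Sum>y\<in>{..<m} \<rightarrow>\<^sub>E half_interval N. (\<Prod>i<m. mirror_weight N (y i)) * det_product f m e N y)"
    by (rule sum_PiE_mirror) (rule det_product_mirror)
  also have "\<dots> = fact m * (\<Sum>y\<in>incseqs m (half_interval N).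
      (\<Prod>i<m. mirror_weight N (y i)) * det_product f m e N y)"
  proof (rule sum_symmetric)
    fix y :: "nat \<Rightarrow> int" and a b assume ab: "a < m" "b < m" "a \<noteq> b"
    let ?t = "Transposition.transpose a b"
    have t: "?t permutes {..<m}" using ab by (auto intro!: permutes_swap_id)
    have "(\<Prod>i<m. mirror_weight N ((y \<circ> ?t) i)) = (\<Prod>i<m. mirror_weight N (y i))"
      using prod.permute[OF t, of "\<lambda>i. mirror_weight N (y i)"] by (simp add: o_def)
    moreover have "rdet m (\<lambda>i j. g (2 * j + e) (2 * (y \<circ> ?t) i - N)) = - rdet m (\<lambda>i j. g (2 * j + e) (2 * y i - N))"
      for g :: "nat \<Rightarrow> int \<Rightarrow> real"
      using rdet_permute_rows[OF t, of "\<lambda>i j. g (2 * j + e) (2 * y i - N)"] ab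
      by (simp add: sign_swap_id)
    ultimately show "(\<Prod>i<m. mirror_weight N ((y \<circ> ?t) i)) * det_product f m e N (y \<circ> ?t)
        = (\<Prod>i<m. mirror_weight N (y i)) * det_product f m e N y"
      by (simp only: det_product_def minus_mult_minus)
  next
    fix y :: "nat \<Rightarrow> int" assume "\<not> inj_on y {..<m}"
    then obtain a b where "a < m" "b < m" "a \<noteq> b" "y a = y b"
      by (auto simp: inj_on_def)
    then have "det_product f m e N y = 0"
      unfolding det_product_def by (subst (2) rdet_equal_rows[of a _ b]) auto
    then show "(\<Prod>i<m. mirror_weight N (y i)) * det_product f m e N y = 0" by simp
  qed simp
  finally show ?thesis .
qed

text \<open>Only the first entry of an increasing sequence in the upper half can be the
  midpoint.\<close>

lemma prod_mirror_weight:
  assumes "y \<in> incseqs (Suc m) (half_interval N)"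
  shows "(\<Prod>i<Suc m. mirror_weight N (y i)) = mirror_weight N (y 0) * 2 ^ m"
proof -
  have "mirror_weight N (y (Suc i)) = 2" if "i < m" for i
  proof -
    have "y 0 < y (Suc i)" using assms that by (intro incseqs_less) auto
    moreover have "N \<le> 2 * y 0" using assms by (auto simp: incseqs_def half_interval_def)
    ultimately show ?thesis by (simp add: mirror_weight_def)
  qed
  then show ?thesis by (simp only: prod.lessThan_Suc_shift) simp
qed

text \<open>The source of the averages: telescoping from both sides leaves the values at
  \<open>2 * y - N - 1\<close> and \<open>2 * y - N + 1\<close>, because \<open>y\<close> belongs to
  neither sum.\<close>

lemma central_difference_of_sums:
  assumes "0 \<le> y" "y \<le> N"
  shows "(\<Sum>x\<in>{0..<y}. f j (2 * x - N)) - (\<Sum>x\<in>{y<..N}. f j (2 * x - N))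
    = 2 * averaged f (Suc j) (2 * y - N) - (f (Suc j) (N + 1) + f (Suc j) (- N - 1))"
proof -
  have "{0..<y} = {0..y - 1}" "{y<..N} = {y + 1..N}" by auto
  then show ?thesis
    using central_family_sum[OF f, of 0 "y - 1" j "- N"] central_family_sum[OF f, of "y + 1" N j "- N"] assms
    by (simp add: averaged_def algebra_simps)
qed

text \<open>Antidifferences of the even columns have odd index, so the boundary terms at
  \<open>N + 1\<close> and \<open>- N - 1\<close> cancel and every row is exactly twice an averaged
  one.\<close>

lemma sum_incseqs_even:
  "fact m * (\<Sum>x\<in>incseqs (m + m) {0..N}. rdet (m + m) (\<lambda>i j. f j (2 * x i - N)))
    = 2 ^ m * (\<Sum>y\<in>{..<m} \<rightarrow>\<^sub>E {0..N}. det_product f m 1 N y)"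
proof -
  have reflect: "f j (N - 2 * x) = (if even j then 1 else - 1) * f j (2 * x - N)" for x j
    using central_family_minus[OF f, of j "2 * x - N"] by simp
  have "- N - 1 = - (N + 1)" by simp
  then have bd: "f (Suc (2 * j)) (- N - 1) = - f (Suc (2 * j)) (N + 1)" for j
    by (simp only: central_family_minus[OF f]) simp
  have "fact m * (\<Sum>x\<in>incseqs (m + m) {0..N}. rdet (m + m) (\<lambda>i. (\<lambda>x j. f j (2 * x - N)) (x i)))
    = (\<Sum>y\<in>{..<m} \<rightarrow>\<^sub>E {0..N}.
        rdet m (\<lambda>i j. (\<Sum>x\<in>{0..<y i}. f (2 * j) (2 * x - N)) - (\<Sum>x\<in>{y i<..N}. f (2 * j) (2 * x - N)))
      * rdet m (\<lambda>i j. f (2 * j + 1) (2 * y i - N)))"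
    by (rule sum_incseqs_rdet[where s = 1]) (simp_all add: reflect)
  also have "\<dots> = (\<Sum>y\<in>{..<m} \<rightarrow>\<^sub>E {0..N}. 2 ^ m * det_product f m 1 N y)"
  proof (intro sum.cong refl)
    fix y assume y: "y \<in> {..<m} \<rightarrow>\<^sub>E {0..N}"
    have "rdet m (\<lambda>i j. (\<Sum>x\<in>{0..<y i}. f (2 * j) (2 * x - N)) - (\<Sum>x\<in>{y i<..N}. f (2 * j) (2 * x - N)))
        = rdet m (\<lambda>i j. 2 * averaged f (2 * j + 1) (2 * y i - N))"
    proof (rule rdet_cong)
      fix i j assume "i < m"
      then have "0 \<le> y i" "y i \<le> N" using y by (auto simp: PiE_iff)
      then show "(\<Sum>x\<in>{0..<y i}. f (2 * j) (2 * x - N)) - (\<Sum>x\<in>{y i<..N}. f (2 * j) (2 * x - N))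
          = 2 * averaged f (2 * j + 1) (2 * y i - N)"
        using central_difference_of_sums[of "y i" N "2 * j"] bd[of j] by simp
    qed
    also have "\<dots> = 2 ^ m * rdet m (\<lambda>i j. averaged f (2 * j + 1) (2 * y i - N))"
      by (simp only: rdet_scale_rows) simp
    finally show "rdet m (\<lambda>i j. (\<Sum>x\<in>{0..<y i}. f (2 * j) (2 * x - N)) - (\<Sum>x\<in>{y i<..N}. f (2 * j) (2 * x - N)))
      * rdet m (\<lambda>i j. f (2 * j + 1) (2 * y i - N)) = 2 ^ m * det_product f m 1 N y"
      by (simp add: det_product_def)
  qed
  finally show ?thesis by (simp add: sum_distrib_left)
qed

text \<open>If the first entry is the midpoint, its row consists of odd functions at zero and the
  second determinant vanishes. All other sequences lie strictly above the midpoint, where every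
  weight is two.\<close>

lemma sum_weighted_det_product_odd:
  "(\<Sum>y\<in>incseqs (Suc p) (half_interval N). (\<Prod>i<Suc p. mirror_weight N (y i)) * det_product f (Suc p) 1 N y)
    = 2 ^ Suc p * (\<Sum>y | y \<in> incseqs (Suc p) {0..N} \<and> N < 2 * y 0. det_product f (Suc p) 1 N y)"
proof -
  let ?Q = "{y \<in> incseqs (Suc p) {0..N}. N < 2 * y 0}"
  have Q: "?Q \<subseteq> incseqs (Suc p) (half_interval N)"
  proof
    fix y assume y: "y \<in> ?Q"
    have "y 0 \<le> y i" if "i < Suc p" for i
      using y that incseqs_less[of y "Suc p" "{0..N}" 0 i] by (cases "i = 0") auto
    then have "y i \<in> half_interval N" if "i < Suc p" for i
      using y that by (fastforce simp: incseqs_def half_interval_def)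
    with y show "y \<in> incseqs (Suc p) (half_interval N)"
      by (auto simp: incseqs_def PiE_iff)
  qed
  have "(\<Sum>y\<in>incseqs (Suc p) (half_interval N). (\<Prod>i<Suc p. mirror_weight N (y i)) * det_product f (Suc p) 1 N y)
      = (\<Sum>y\<in>?Q. (\<Prod>i<Suc p. mirror_weight N (y i)) * det_product f (Suc p) 1 N y)"
  proof (intro sum.mono_neutral_right ballI Q)
    fix y assume y: "y \<in> incseqs (Suc p) (half_interval N) - ?Q"
    have mem: "y i \<in> {0..N}" "N \<le> 2 * y i" if "i < Suc p" for i
      using y that by (auto simp: incseqs_def half_interval_def PiE_iff)
    then have "y \<in> incseqs (Suc p) {0..N}"
      using y by (auto simp: incseqs_def PiE_iff)
    with y mem(2)[of 0] have zero: "2 * y 0 - N = 0" by auto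
    have "f (2 * j + 1) 0 = 0" for j
      using central_family_minus[OF f, of "2 * j + 1" 0] by simp
    then have "rdet (Suc p) (\<lambda>i j. f (2 * j + 1) (2 * y i - N)) = 0"
      by (intro rdet_zero_row[of 0]) (simp_all add: zero)
    then show "(\<Prod>i<Suc p. mirror_weight N (y i)) * det_product f (Suc p) 1 N y = 0"
      by (simp add: det_product_def)
  qed simp
  also have "\<dots> = (\<Sum>y\<in>?Q. 2 ^ Suc p * det_product f (Suc p) 1 N y)"
  proof (intro sum.cong refl)
    fix y assume "y \<in> ?Q"
    then show "(\<Prod>i<Suc p. mirror_weight N (y i)) * det_product f (Suc p) 1 N y
        = 2 ^ Suc p * det_product f (Suc p) 1 N y"
      using prod_mirror_weight[of y p N] Q by (auto simp: mirror_weight_def)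
  qed
  finally show ?thesis by (simp add: sum_distrib_left)
qed

text \<open>The weight two of a first entry above \<open>N / 2\<close> is spent on reflecting that
  entry: the product is invariant, and the reflected sequence is still increasing with
  \<open>N < y 0 + y 1\<close>. The other entries account for \<open>2 ^ p\<close>.\<close>

lemma sum_weighted_det_product_even:
  "(\<Sum>y\<in>incseqs (Suc p) (half_interval N). (\<Prod>i<Suc p. mirror_weight N (y i)) * det_product f (Suc p) 0 N y)
    = 2 ^ p * (\<Sum>y | y \<in> incseqs (Suc p) {0..N} \<and> (p > 0 \<longrightarrow> N < y 0 + y 1). det_product f (Suc p) 0 N y)"
proof -
  let ?h = "det_product f (Suc p) 0 N"
  let ?flip = "\<lambda>y. y(0 := N - y 0)"
  define Q where "Q = {y \<in> incseqs (Suc p) {0..N}. p > 0 \<longrightarrow> N < y 0 + y 1}"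
  define H where "H = incseqs (Suc p) (half_interval N)"
  define H' where "H' = {y \<in> H. N < 2 * y 0}"
  have fin: "finite Q" "finite H" "finite H'" by (simp_all add: Q_def H_def H'_def)
  have iff: "y \<in> H \<longleftrightarrow> y \<in> incseqs (Suc p) {0..N} \<and> N \<le> 2 * y 0" for y
  proof
    assume "y \<in> H"
    then show "y \<in> incseqs (Suc p) {0..N} \<and> N \<le> 2 * y 0"
      by (auto simp: H_def incseqs_def half_interval_def PiE_iff)
  next
    assume y: "y \<in> incseqs (Suc p) {0..N} \<and> N \<le> 2 * y 0"
    have "y 0 \<le> y i" if "i < Suc p" for i
      using y that incseqs_less[of y "Suc p" "{0..N}" 0 i] by (cases "i = 0") auto
    then have "y i \<in> half_interval N" if "i < Suc p" for i
      using y that by (fastforce simp: incseqs_def half_interval_def)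
    with y show "y \<in> H"
      by (auto simp: H_def incseqs_def PiE_iff)
  qed
  have less01: "y 0 < y 1" if "y \<in> incseqs (Suc p) X" "p > 0" for y X
    using that incseqs_less[OF that(1), of 0 1] by simp
  have Q_ge: "{y \<in> Q. N \<le> 2 * y 0} = H"
    using less01 by (auto simp: Q_def iff) (smt (verit) less01)
  have "(\<Sum>y\<in>{y \<in> Q. \<not> N \<le> 2 * y 0}. ?h y) = (\<Sum>y\<in>H'. ?h y)"
  proof (rule sum.reindex_bij_witness[of _ ?flip ?flip])
    fix y assume "y \<in> {y \<in> Q. \<not> N \<le> 2 * y 0}"
    then have y: "y \<in> incseqs (Suc p) {0..N}" "p > 0 \<longrightarrow> N < y 0 + y 1" "2 * y 0 < N"
      by (auto simp: Q_def)
    then show "?flip y \<in> H'"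
      by (auto simp: H'_def iff incseqs_def PiE_iff extensional_def less_Suc_eq_0_disj all_conj_distrib)
  next
    fix y assume "y \<in> H'"
    then have y: "y \<in> incseqs (Suc p) {0..N}" "N < 2 * y 0" by (auto simp: H'_def iff)
    with less01[OF y(1)] show "?flip y \<in> {y \<in> Q. \<not> N \<le> 2 * y 0}"
      by (auto simp: Q_def incseqs_def PiE_iff extensional_def less_Suc_eq_0_disj all_conj_distrib)
  qed (auto simp: det_product_mirror)
  moreover have "(\<Sum>y\<in>Q. ?h y) = (\<Sum>y\<in>{y \<in> Q. N \<le> 2 * y 0}. ?h y) + (\<Sum>y\<in>{y \<in> Q. \<not> N \<le> 2 * y 0}. ?h y)"
    using fin by (subst sum.union_disjoint[symmetric]) (auto intro!: sum.cong)
  moreover have "(\<Sum>y\<in>H. mirror_weight N (y 0) * ?h y) = (\<Sum>y\<in>H. ?h y) + (\<Sum>y\<in>H'. ?h y)"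
  proof -
    have "(\<Sum>y\<in>H'. ?h y) = (\<Sum>y\<in>H. if N < 2 * y 0 then ?h y else 0)"
      unfolding H'_def using fin by (simp add: sum.inter_filter)
    then show ?thesis
      by (simp add: sum.distrib[symmetric]) (auto intro!: sum.cong simp: mirror_weight_def iff)
  qed
  ultimately have "(\<Sum>y\<in>Q. ?h y) = (\<Sum>y\<in>H. mirror_weight N (y 0) * ?h y)"
    by (simp add: Q_ge)
  moreover have "(\<Sum>y\<in>H. (\<Prod>i<Suc p. mirror_weight N (y i)) * ?h y)
      = (\<Sum>y\<in>H. 2 ^ p * (mirror_weight N (y 0) * ?h y))"
    by (intro sum.cong refl, subst prod_mirror_weight) (auto simp: H_def)
  ultimately show ?thesis
    by (simp add: Q_def H_def sum_distrib_left)
qed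

lemma sum_incseqs_odd:
  assumes "N \<ge> 0"
  shows "fact (Suc p) * (\<Sum>x\<in>incseqs (Suc (p + p)) {0..N}. rdet (Suc (p + p)) (\<lambda>i j. f j (2 * x i - N)))
    = 2 ^ p * (\<Sum>y\<in>{..<Suc p} \<rightarrow>\<^sub>E {0..N}. det_product f (Suc p) 0 N y)"
proof -
  \<comment> \<open>Column \<open>0\<close> carries the two border points; the functions move up by
    one column and are zero at the border. Even columns thereby change sign under reflection, hence
    \<open>s = - 1\<close>.\<close>
  define r :: "int \<Rightarrow> nat \<Rightarrow> real" where "r x j =
    (if j = 0 then if x = - 1 then 1 / 2 else if x = N + 1 then - 1 / 2 else 0
     else if 0 \<le> x \<and> x \<le> N then f (j - 1) (2 * x - N) else 0)" for x j
  define d where "d y j = (\<Sum>x\<in>{- 1..<y}. r x (2 * j)) - (\<Sum>x\<in>{y<..N + 1}. r x (2 * j))" for y j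
  let ?X = "{- 1..N + 1}"
  have reflect: "r (N - x) j = (if even j then - 1 else 1) * r x j" for x j
  proof (cases j)
    case (Suc i)
    then show ?thesis
      using central_family_minus[OF f, of i "2 * x - N"] by (auto simp: r_def)
  qed (use \<open>N \<ge> 0\<close> in \<open>auto simp: r_def\<close>)
  have inside: "{- 1<..<N + 1} = {0..N}" by auto
  have "(\<Sum>x\<in>incseqs (Suc (Suc (p + p))) ?X. rdet (Suc (Suc (p + p))) (\<lambda>i. r (x i)))
      = (\<Sum>x\<in>incseqs (Suc (p + p)) {0..N}. rdet (Suc (p + p)) (\<lambda>i j. r (x i) (Suc j)))"
    unfolding inside[symmetric]
    by (rule sum_incseqs_border) (use \<open>N \<ge> 0\<close> in \<open>auto simp: r_def\<close>)
  also have "\<dots> = (\<Sum>x\<in>incseqs (Suc (p + p)) {0..N}. rdet (Suc (p + p)) (\<lambda>i j. f j (2 * x i - N)))"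
    by (intro sum.cong refl rdet_cong) (auto simp: r_def incseqs_def PiE_iff)
  finally have "fact (Suc p) * (\<Sum>x\<in>incseqs (Suc (p + p)) {0..N}. rdet (Suc (p + p)) (\<lambda>i j. f j (2 * x i - N)))
      = fact (Suc p) * (\<Sum>x\<in>incseqs (Suc p + Suc p) ?X. rdet (Suc p + Suc p) (\<lambda>i. r (x i)))"
    by simp
  also have "\<dots> = (\<Sum>y\<in>{..<Suc p} \<rightarrow>\<^sub>E ?X. rdet (Suc p) (\<lambda>i. d (y i)) * rdet (Suc p) (\<lambda>i j. r (y i) (2 * j + 1)))"
    unfolding d_def by (rule sum_incseqs_rdet[where s = "- 1"]) (simp_all add: reflect)
  \<comment> \<open>Odd columns vanish at the border points, so a border value of any variable gives
    the second determinant a zero row.\<close>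
  also have "\<dots> = (\<Sum>y\<in>{..<Suc p} \<rightarrow>\<^sub>E {0..N}. rdet (Suc p) (\<lambda>i. d (y i)) * rdet (Suc p) (\<lambda>i j. r (y i) (2 * j + 1)))"
  proof (rule sum.mono_neutral_right)
    show "\<forall>y\<in>({..<Suc p} \<rightarrow>\<^sub>E ?X) - ({..<Suc p} \<rightarrow>\<^sub>E {0..N}).
        rdet (Suc p) (\<lambda>i. d (y i)) * rdet (Suc p) (\<lambda>i j. r (y i) (2 * j + 1)) = 0"
    proof
      fix y assume "y \<in> ({..<Suc p} \<rightarrow>\<^sub>E ?X) - ({..<Suc p} \<rightarrow>\<^sub>E {0..N})"
      then obtain i where "i < Suc p" "y i \<notin> {0..N}"
        by (auto simp: PiE_iff)
      then have "rdet (Suc p) (\<lambda>i j. r (y i) (2 * j + 1)) = 0"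
        by (intro rdet_zero_row[of i]) (auto simp: r_def)
      then show "rdet (Suc p) (\<lambda>i. d (y i)) * rdet (Suc p) (\<lambda>i j. r (y i) (2 * j + 1)) = 0"
        by simp
    qed
    show "{..<Suc p} \<rightarrow>\<^sub>E {0..N} \<subseteq> {..<Suc p} \<rightarrow>\<^sub>E ?X" by (intro PiE_mono) auto
  qed (simp add: finite_PiE)
  also have "\<dots> = (\<Sum>y\<in>{..<Suc p} \<rightarrow>\<^sub>E {0..N}. 2 ^ p * det_product f (Suc p) 0 N y)"
  proof (intro sum.cong refl)
    fix y assume y: "y \<in> {..<Suc p} \<rightarrow>\<^sub>E {0..N}"
    have ys: "0 \<le> y i" "y i \<le> N" if "i < Suc p" for i
      using y that by (auto simp: PiE_iff)
    \<comment> \<open>Here the antidifferences have even index and the boundary terms add up instead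
      of cancelling. Column \<open>0\<close> of \<open>d\<close> is constantly
      \<open>1 / 2 + 1 / 2 = 1\<close>, so a multiple of it removes \<open>K j\<close>. Only the
      remaining columns carry the factor two.\<close>
    define K where "K j = f (2 * j) (N + 1) + f (2 * j) (- N - 1)" for j
    define R where "R i j = (if j = 0 then 1 else 2) * averaged f (2 * j) (2 * y i - N)" for i j
    have "rdet (Suc p) (\<lambda>i. d (y i)) = rdet (Suc p) (\<lambda>i j. R i j + (\<Sum>l<j. (if l = 0 then - K j else 0) * R i l))"
    proof (rule rdet_cong)
      fix i j assume i: "i < Suc p"
      show "d (y i) j = R i j + (\<Sum>l<j. (if l = 0 then - K j else 0) * R i l)"
      proof (cases j)
        case 0
        have "(\<Sum>x\<in>{- 1..<y i}. r x 0) = (\<Sum>x\<in>{- 1}. r x 0)"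
          using ys[OF i] by (intro sum.mono_neutral_right) (auto simp: r_def)
        moreover have "(\<Sum>x\<in>{y i<..N + 1}. r x 0) = (\<Sum>x\<in>{N + 1}. r x 0)"
          using ys[OF i] by (intro sum.mono_neutral_right) (auto simp: r_def)
        ultimately show ?thesis
          using 0 \<open>N \<ge> 0\<close> central_family_0[OF central_family_averaged[OF f]]
          by (simp add: d_def R_def r_def)
      next
        case (Suc l)
        have "(\<Sum>x\<in>{- 1..<y i}. r x (2 * j)) = (\<Sum>x\<in>{0..<y i}. f (2 * l + 1) (2 * x - N))"
          using ys[OF i] Suc by (intro sum.mono_neutral_cong_right) (auto simp: r_def)
        moreover have "(\<Sum>x\<in>{y i<..N + 1}. r x (2 * j)) = (\<Sum>x\<in>{y i<..N}. f (2 * l + 1) (2 * x - N))"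
          using ys[OF i] Suc by (intro sum.mono_neutral_cong_right) (auto simp: r_def)
        moreover have "(\<Sum>l<j. (if l = 0 then - K j else 0) * R i l) = - K j"
          unfolding Suc sum.lessThan_Suc_shift
          using central_family_0[OF central_family_averaged[OF f]] by (simp add: R_def)
        ultimately show ?thesis
          using central_difference_of_sums[of "y i" N "2 * l + 1"] ys[OF i] Suc
          by (simp add: d_def R_def K_def)
      qed
    qed
    also have "\<dots> = rdet (Suc p) R"
      by (rule rdet_add_earlier_cols)
    also have "\<dots> = (\<Prod>j<Suc p. if j = 0 then 1 else 2) * rdet (Suc p) (\<lambda>i j. averaged f (2 * j) (2 * y i - N))"
      unfolding R_def by (rule rdet_scale_cols)
    also have "(\<Prod>j<Suc p. if j = 0 then 1 else 2) = (2 :: real) ^ p"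
      unfolding prod.lessThan_Suc_shift by simp
    finally have "rdet (Suc p) (\<lambda>i. d (y i)) = 2 ^ p * rdet (Suc p) (\<lambda>i j. averaged f (2 * j) (2 * y i - N))" .
    moreover have "rdet (Suc p) (\<lambda>i j. r (y i) (2 * j + 1)) = rdet (Suc p) (\<lambda>i j. f (2 * j) (2 * y i - N))"
      by (rule rdet_cong) (use ys in \<open>auto simp: r_def\<close>)
    ultimately show "rdet (Suc p) (\<lambda>i. d (y i)) * rdet (Suc p) (\<lambda>i j. r (y i) (2 * j + 1))
        = 2 ^ p * det_product f (Suc p) 0 N y"
      by (simp add: det_product_def)
  qed
  finally show ?thesis by (simp add: sum_distrib_left)
qed

text \<open>One power of two comes from the averaged functions and an equal one from the mirror
  weights. The factorials from passing to independent variables and back cancel.\<close>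

theorem sum_rdet_eq_sum_det_product:
  assumes "N \<ge> 0"
  shows "(\<Sum>x\<in>incseqs (Suc k) {0..N}. rdet (Suc k) (\<lambda>i j. f j (2 * x i - N)))
    = 4 ^ (Suc k div 2) * (\<Sum>y\<in>mirror_domain k N. det_product f (Suc (k div 2)) (k mod 2) N y)"
proof (cases "odd k")
  case True
  then obtain p where k: "k = 2 * p + 1" by (elim oddE)
  have "fact (Suc p) * (\<Sum>x\<in>incseqs (Suc p + Suc p) {0..N}. rdet (Suc p + Suc p) (\<lambda>i j. f j (2 * x i - N)))
      = 2 ^ Suc p * (fact (Suc p) * (2 ^ Suc p * (\<Sum>y\<in>mirror_domain k N. det_product f (Suc p) 1 N y)))"
    unfolding sum_incseqs_even sum_det_product sum_weighted_det_product_odd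
    by (simp add: mirror_domain_def k)
  also have "\<dots> = fact (Suc p) * (4 ^ Suc p * (\<Sum>y\<in>mirror_domain k N. det_product f (Suc p) 1 N y))"
    by (simp add: power_mult_distrib[symmetric])
  finally have "(\<Sum>x\<in>incseqs (Suc p + Suc p) {0..N}. rdet (Suc p + Suc p) (\<lambda>i j. f j (2 * x i - N)))
      = 4 ^ Suc p * (\<Sum>y\<in>mirror_domain k N. det_product f (Suc p) 1 N y)"
    by (simp only: mult_cancel_left fact_nonzero simp_thms)
  moreover have "Suc k = Suc p + Suc p" "Suc k div 2 = Suc p" "Suc (k div 2) = Suc p" "k mod 2 = 1"
    using k by simp_all
  ultimately show ?thesis by simp
next
  case False
  then obtain p where k: "k = 2 * p" by auto
  have "fact (Suc p) * (\<Sum>x\<in>incseqs (Suc (p + p)) {0..N}. rdet (Suc (p + p)) (\<lambda>i j. f j (2 * x i - N)))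
      = 2 ^ p * (fact (Suc p) * (2 ^ p * (\<Sum>y\<in>mirror_domain k N. det_product f (Suc p) 0 N y)))"
    unfolding sum_incseqs_odd[OF assms] sum_det_product sum_weighted_det_product_even
    by (simp add: mirror_domain_def k)
  also have "\<dots> = fact (Suc p) * (4 ^ p * (\<Sum>y\<in>mirror_domain k N. det_product f (Suc p) 0 N y))"
    by (simp add: power_mult_distrib[symmetric])
  finally have "(\<Sum>x\<in>incseqs (Suc (p + p)) {0..N}. rdet (Suc (p + p)) (\<lambda>i j. f j (2 * x i - N)))
      = 4 ^ p * (\<Sum>y\<in>mirror_domain k N. det_product f (Suc p) 0 N y)"
    by (simp only: mult_cancel_left fact_nonzero simp_thms)
  moreover have "Suc k = Suc (p + p)" "Suc k div 2 = p" "Suc (k div 2) = Suc p" "k mod 2 = 0"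
    using k by simp_all
  ultimately show ?thesis by simp
qed

end

section \<open>Plane partitions as chains of rows\<close>

definition gt_tops :: "int \<Rightarrow> nat \<Rightarrow> row set" where
  "gt_tops c k = {x \<in> {..<Suc k} \<rightarrow>\<^sub>E {0..c}. \<forall>i<k. x i \<le> x (Suc i)}"

text \<open>
  Row \<open>t\<close> is the diagonal \<open>j - i = k - t\<close>, read from its lower right end so that it is increasing;
  the box has side \<open>k + 1\<close>. The same convention is used in \<open>diag_rows\<close>, where only the cells with
  \<open>i + j \<le> k + 2\<close> occur.
\<close>

definition sym_rows :: "nat \<Rightarrow> (nat \<times> nat \<Rightarrow> int) \<Rightarrow> nat \<Rightarrow> row" where
  "sym_rows k \<pi> t = (if t \<le> k then \<lambda>a\<in>{..<Suc t}. \<pi> (Suc t - a, Suc k - a) else undefined)"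

text \<open>The index \<open>i + k - j\<close> is \<open>k - (j - i)\<close>, the level of the
  diagonal through the cell, written so that the natural subtraction does not truncate.\<close>

definition sym_array :: "nat \<Rightarrow> (nat \<Rightarrow> row) \<Rightarrow> nat \<times> nat \<Rightarrow> int" where
  "sym_array k g = (\<lambda>(i, j)\<in>{1..Suc k} \<times> {1..Suc k}.
     if i \<le> j then g (i + k - j) (Suc k - j) else g (j + k - i) (Suc k - i))"

text \<open>Interlacing of two adjacent diagonals is the monotonicity between their cells along rows
  and down columns; symmetry supplies the cells below the main diagonal.\<close>

lemma card_symmetric_pp:
  "card {\<pi> \<in> plane_partitions (Suc k) (Suc k) c. symmetric_pp (Suc k) \<pi>}
    = (\<Sum>x\<in>gt_tops (int c) k. chain_count gt_rows k x)"
proof -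
  let ?P = "{\<pi> \<in> plane_partitions (Suc k) (Suc k) c. symmetric_pp (Suc k) \<pi>}"
  let ?S = "SIGMA x:gt_tops (int c) k. row_chains gt_rows k x"
  have "bij_betw (\<lambda>\<pi>. (sym_rows k \<pi> k, sym_rows k \<pi>)) ?P ?S"
  proof (rule bij_betw_byWitness[where f' = "\<lambda>(x, g). sym_array k g"])
    show "\<forall>\<pi>\<in>?P. (\<lambda>(x, g). sym_array k g) (sym_rows k \<pi> k, sym_rows k \<pi>) = \<pi>"
    proof
      fix \<pi> assume \<pi>: "\<pi> \<in> ?P"
      have ext: "\<pi> \<in> extensional ({1..Suc k} \<times> {1..Suc k})"
        using \<pi> by (auto simp: plane_partitions_def PiE_def)
      have sym: "\<pi> (i, j) = \<pi> (j, i)" if "i \<in> {1..Suc k}" "j \<in> {1..Suc k}" for i j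
        using \<pi> that by (simp add: symmetric_pp_def)
      have half: "sym_rows k \<pi> (i + k - j) (Suc k - j) = \<pi> (i, j)" if "1 \<le> i" "i \<le> j" "j \<le> Suc k" for i j
        using that by (auto simp: sym_rows_def)
      show "(\<lambda>(x, g). sym_array k g) (sym_rows k \<pi> k, sym_rows k \<pi>) = \<pi>"
        using ext by (intro extensionalityI[of _ "{1..Suc k} \<times> {1..Suc k}"])
          (auto simp: sym_array_def half sym[symmetric])
    qed
    show "\<forall>z\<in>?S. (\<lambda>\<pi>. (sym_rows k \<pi> k, sym_rows k \<pi>)) ((\<lambda>(x, g). sym_array k g) z) = z"
    proof
      fix z assume "z \<in> ?S"
      then obtain x g where z: "z = (x, g)" and x: "x \<in> gt_tops (int c) k" and g: "g \<in> row_chains gt_rows k x"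
        by auto
      have ext: "g t \<in> extensional {..<Suc t}" if "t \<le> k" for t
      proof (cases "t = k")
        case True
        then show ?thesis using x g by (auto simp: row_chains_def gt_tops_def PiE_def)
      next
        case False
        then have "g t \<in> gt_rows t (g (Suc t))" using g that by (auto simp: row_chains_def)
        then show ?thesis by (simp add: gt_rows_def PiE_def)
      qed
      have "sym_rows k (sym_array k g) t = g t" for t
      proof (cases "t \<le> k")
        case True
        show ?thesis
          using ext[OF True] True
          by (intro extensionalityI[of _ "{..<Suc t}"]) (auto simp: sym_rows_def sym_array_def)
      next
        case False
        then show ?thesis using g by (auto simp: sym_rows_def row_chains_def)
      qed
      then have "sym_rows k (sym_array k g) = g" by blast
      moreover have "g k = x" using g by (simp add: row_chains_def)
      ultimately show "(\<lambda>\<pi>. (sym_rows k \<pi> k, sym_rows k \<pi>)) ((\<lambda>(x, g). sym_array k g) z) = z"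
        by (simp add: z)
    qed
    show "(\<lambda>\<pi>. (sym_rows k \<pi> k, sym_rows k \<pi>)) ` ?P \<subseteq> ?S"
    proof
      fix z assume "z \<in> (\<lambda>\<pi>. (sym_rows k \<pi> k, sym_rows k \<pi>)) ` ?P"
      then obtain \<pi> where z: "z = (sym_rows k \<pi> k, sym_rows k \<pi>)" and \<pi>: "\<pi> \<in> ?P" by auto
      have range: "\<pi> (i, j) \<in> {0..int c}" if "1 \<le> i" "i \<le> Suc k" "1 \<le> j" "j \<le> Suc k" for i j
        using \<pi> that by (auto simp: plane_partitions_def PiE_iff)
      have down: "\<pi> (Suc i, j) \<le> \<pi> (i, j)" if "1 \<le> i" "i \<le> k" "1 \<le> j" "j \<le> Suc k" for i j
        using \<pi> that by (auto simp: plane_partitions_def)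
      have right: "\<pi> (i, Suc j) \<le> \<pi> (i, j)" if "1 \<le> i" "i \<le> Suc k" "1 \<le> j" "j \<le> k" for i j
        using \<pi> that by (auto simp: plane_partitions_def)
      have "sym_rows k \<pi> k \<in> gt_tops (int c) k"
      proof -
        have "\<pi> (Suc k - a, Suc k - a) \<le> \<pi> (k - a, k - a)" if "a < k" for a
        proof -
          have "1 \<le> k - a" using that by simp
          then have "\<pi> (Suc (k - a), Suc (k - a)) \<le> \<pi> (k - a, k - a)"
            using down[of "k - a" "Suc (k - a)"] right[of "k - a" "k - a"] by simp
          then show ?thesis using that by (simp add: Suc_diff_le)
        qed
        then show ?thesis
          using range by (auto simp: gt_tops_def sym_rows_def)
      qed
      moreover have "sym_rows k \<pi> s \<in> gt_rows s (sym_rows k \<pi> (Suc s))" if "s < k" for s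
      proof -
        have "\<pi> (Suc (Suc s) - a, Suc k - a) \<le> \<pi> (Suc s - a, Suc k - a)"
          "\<pi> (Suc s - a, Suc k - a) \<le> \<pi> (Suc s - a, k - a)" if "a < Suc s" for a
          using down[of "Suc s - a" "Suc k - a"] right[of "Suc s - a" "k - a"] that \<open>s < k\<close>
          by (simp_all add: Suc_diff_le)
        then show ?thesis
          using that by (auto simp: gt_rows_def sym_rows_def)
      qed
      ultimately show "z \<in> ?S"
        by (auto simp: z row_chains_def sym_rows_def)
    qed
    show "(\<lambda>(x, g). sym_array k g) ` ?S \<subseteq> ?P"
    proof
      fix \<pi> assume "\<pi> \<in> (\<lambda>(x, g). sym_array k g) ` ?S"
      then obtain x g where \<pi>: "\<pi> = sym_array k g"
        and x: "x \<in> gt_tops (int c) k" and g: "g \<in> row_chains gt_rows k x"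
        by auto
      have lower: "g (Suc s) a \<le> g s a" and upper: "g s a \<le> g (Suc s) (Suc a)" if "s < k" "a \<le> s" for s a
      proof -
        have "g s \<in> gt_rows s (g (Suc s))" using g that by (simp add: row_chains_def)
        then have "g s a \<in> {g (Suc s) a..g (Suc s) (Suc a)}"
          using that PiE_mem[of "g s" "{..<Suc s}" "\<lambda>i. {g (Suc s) i..g (Suc s) (Suc i)}" a]
          by (simp add: gt_rows_def)
        then show "g (Suc s) a \<le> g s a" "g s a \<le> g (Suc s) (Suc a)" by auto
      qed
      \<comment> \<open>Each entry of a row lies between two entries of the row one level higher, so
        bounds spread downwards from level \<open>k\<close>.\<close>
      have range: "\<forall>a\<le>s. g s a \<in> {0..int c}" if "s \<le> k" for s
        using that
      proof (induction rule: inc_induct)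
        case base
        have "x \<in> {..<Suc k} \<rightarrow>\<^sub>E {0..int c}" "g k = x"
          using x g by (auto simp: gt_tops_def row_chains_def)
        then show ?case by (auto simp: PiE_iff)
      next
        case (step s)
        show ?case
        proof (intro allI impI)
          fix a assume a: "a \<le> s"
          have "g (Suc s) a \<in> {0..int c}" "g (Suc s) (Suc a) \<in> {0..int c}"
            using step.IH a by auto
          then show "g s a \<in> {0..int c}"
            using lower[OF step.hyps(2) a] upper[OF step.hyps(2) a] by auto
        qed
      qed
      have above: "\<pi> (i, j) = g (i + k - j) (Suc k - j)" if "1 \<le> i" "i \<le> j" "j \<le> Suc k" for i j
        using that by (simp add: \<pi> sym_array_def)
      have below: "\<pi> (i, j) = g (j + k - i) (Suc k - i)" if "1 \<le> j" "j \<le> i" "i \<le> Suc k" for i j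
        using that by (auto simp: \<pi> sym_array_def)
      have "\<pi> \<in> {1..Suc k} \<times> {1..Suc k} \<rightarrow>\<^sub>E {0..int c}"
      proof -
        have "\<pi> (i, j) \<in> {0..int c}" if "1 \<le> i" "i \<le> Suc k" "1 \<le> j" "j \<le> Suc k" for i j
        proof (cases "i \<le> j")
          case True
          then show ?thesis
            unfolding above[OF that(1) True that(4)]
            by (intro range[rule_format]) (use that in auto)
        next
          case False
          then show ?thesis
            using that by (subst below) (auto intro!: range[rule_format] simp del: atLeastAtMost_iff)
        qed
        then show ?thesis
          by (auto simp: PiE_iff \<pi> sym_array_def)
      qed
      moreover have "\<pi> (i + 1, j) \<le> \<pi> (i, j)" if "1 \<le> i" "i + 1 \<le> Suc k" "1 \<le> j" "j \<le> Suc k" for i j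
      proof (cases "i < j")
        case True
        then show ?thesis
          using that lower[of "i + k - j" "Suc k - j"] by (simp add: above Suc_diff_le)
      next
        case False
        then show ?thesis
          using that upper[of "j + k - (i + 1)" "k - i"] by (simp add: below Suc_diff_Suc Suc_diff_le)
      qed
      moreover have "\<pi> (i, j + 1) \<le> \<pi> (i, j)" if "1 \<le> i" "i \<le> Suc k" "1 \<le> j" "j + 1 \<le> Suc k" for i j
      proof (cases "j < i")
        case True
        then show ?thesis
          using that lower[of "j + k - i" "Suc k - i"] by (simp add: below Suc_diff_le)
      next
        case False
        then show ?thesis
          using that upper[of "i + k - (j + 1)" "k - j"] by (simp add: above Suc_diff_Suc Suc_diff_le)
      qed
      moreover have "symmetric_pp (Suc k) \<pi>"
      proof -
        have "\<pi> (i, j) = \<pi> (j, i)" if "1 \<le> i" "i \<le> Suc k" "1 \<le> j" "j \<le> Suc k" for i j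
          using that above[of i j] below[of i j] above[of j i] below[of j i]
          by (cases i j rule: linorder_cases) auto
        then show ?thesis by (auto simp: symmetric_pp_def)
      qed
      ultimately show "\<pi> \<in> ?P"
        by (simp add: plane_partitions_def)
    qed
  qed
  then have "card ?P = card ?S" by (rule bij_betw_same_card)
  also have "\<dots> = (\<Sum>x\<in>gt_tops (int c) k. card (row_chains gt_rows k x))"
  proof (rule card_SigmaI)
    show "finite (gt_tops (int c) k)"
      by (rule finite_subset[of _ "{..<Suc k} \<rightarrow>\<^sub>E {0..int c}"]) (auto simp: gt_tops_def finite_PiE)
  qed (use card_row_chains finite_gt_rows in blast)
  also have "\<dots> = (\<Sum>x\<in>gt_tops (int c) k. chain_count gt_rows k x)"
    using card_row_chains[OF finite_gt_rows] by simp
  finally show ?thesis .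
qed

section \<open>Quasi transpose-complementary plane partitions\<close>

definition qt_tops :: "int \<Rightarrow> nat \<Rightarrow> row set" where
  "qt_tops c k = {x \<in> {..<Suc (k div 2)} \<rightarrow>\<^sub>E {0..c}. qt_top c k x}"

definition diag_rows :: "nat \<Rightarrow> (nat \<times> nat \<Rightarrow> int) \<Rightarrow> nat \<Rightarrow> row" where
  "diag_rows k \<pi> t = (if t \<le> k
     then \<lambda>a\<in>{..<Suc (t div 2)}. \<pi> (Suc (t div 2) - a, Suc (t div 2) - a + (k - t)) else undefined)"

text \<open>The entry of the cell \<open>(i, i + d)\<close>; the subtractions undo the reversed
  reading of the diagonals.\<close>

definition diag_entry :: "nat \<Rightarrow> (nat \<Rightarrow> row) \<Rightarrow> nat \<Rightarrow> nat \<Rightarrow> int" where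
  "diag_entry k g i d = g (k - d) (Suc ((k - d) div 2) - i)"

definition staircase_entry :: "nat \<Rightarrow> (nat \<Rightarrow> row) \<Rightarrow> (nat \<Rightarrow> row) \<Rightarrow> nat \<Rightarrow> nat \<Rightarrow> int" where
  "staircase_entry k g h i j = (if i \<le> j then diag_entry k g i (j - i) else diag_entry k h j (i - j))"

text \<open>The antidiagonal is \<open>i + j = k + 2\<close>. Cells beyond it are complements of
  their mirror images, so the staircase up to and including it determines the array.\<close>

definition qt_array :: "int \<Rightarrow> nat \<Rightarrow> (nat \<Rightarrow> row) \<Rightarrow> (nat \<Rightarrow> row) \<Rightarrow> nat \<times> nat \<Rightarrow> int" where
  "qt_array c k g h = (\<lambda>(i, j)\<in>{1..Suc k} \<times> {1..Suc k}.
     if i + j \<le> k + 2 then staircase_entry k g h i j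
     else c - staircase_entry k g h (k + 2 - j) (k + 2 - i))"

context
  fixes c :: int and k :: nat and x g
  assumes x: "x \<in> qt_tops c k" and g: "g \<in> row_chains (qt_rows c) k x"
begin

lemma qt_chain_extensional:
  assumes "t \<le> k"
  shows "g t \<in> extensional {..<Suc (t div 2)}"
proof (cases "t = k")
  case True
  then show ?thesis using x g by (auto simp: row_chains_def qt_tops_def PiE_def)
next
  case False
  then have "g t \<in> qt_rows c t (g (Suc t))" using g assms by (auto simp: row_chains_def)
  then show ?thesis by (simp add: qt_rows_def PiE_def)
qed

lemma qt_chain_step_odd:
  assumes "s < k" "odd s" "a \<le> s div 2"
  shows "g (Suc s) a \<le> g s a" "a = 0 \<Longrightarrow> c \<le> g (Suc s) 0 + g s 0" "g s a \<le> g (Suc s) (Suc a)"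
proof -
  let ?x = "g (Suc s)"
  have "g s \<in> qt_rows c s ?x" using g assms by (simp add: row_chains_def)
  from PiE_mem[OF this[unfolded qt_rows_def], of a] assms
  have *: "(if a = 0 then max (?x 0) (c - ?x 0) else ?x a) \<le> g s a" "g s a \<le> ?x (Suc a)"
    by auto
  then show "g (Suc s) a \<le> g s a" "g s a \<le> g (Suc s) (Suc a)"
    by (auto split: if_splits)
  show "c \<le> g (Suc s) 0 + g s 0" if "a = 0"
    using *(1) that by auto
qed

lemma qt_chain_step_even:
  assumes "s < k" "even s" "a \<le> s div 2"
  shows "g s a \<le> g (Suc s) a" "a = 0 \<Longrightarrow> c \<le> g (Suc s) 0 + g s 0"
    "a > 0 \<Longrightarrow> g (Suc s) (a - 1) \<le> g s a"
proof -
  let ?x = "g (Suc s)"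
  have "g s \<in> qt_rows c s ?x" using g assms by (simp add: row_chains_def)
  from PiE_mem[OF this[unfolded qt_rows_def], of a] assms
  have *: "(if a = 0 then c - ?x 0 else ?x (a - 1)) \<le> g s a" "g s a \<le> ?x a"
    by auto
  then show "g s a \<le> g (Suc s) a" by simp
  show "c \<le> g (Suc s) 0 + g s 0" if "a = 0" using *(1) that by simp
  show "g (Suc s) (a - 1) \<le> g s a" if "a > 0" using *(1) that by simp
qed

lemma qt_chain_range: "s \<le> k \<Longrightarrow> a \<le> s div 2 \<Longrightarrow> g s a \<in> {0..c}"
proof (induction arbitrary: a rule: inc_induct)
  case base
  have "x \<in> {..<Suc (k div 2)} \<rightarrow>\<^sub>E {0..c}" "g k = x"
    using x g by (auto simp: qt_tops_def row_chains_def)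
  then show ?case using base by (auto simp: PiE_iff)
next
  case (step s)
  have IH: "g (Suc s) b \<in> {0..c}" if "b \<le> Suc s div 2" for b
    using step.IH that by blast
  show ?case
  proof (cases "odd s")
    case True
    then have "a \<le> Suc s div 2" "Suc a \<le> Suc s div 2" using step.prems by presburger+
    then show ?thesis
      using IH[of a] IH[of "Suc a"] qt_chain_step_odd[OF step.hyps(2) True step.prems] by auto
  next
    case False
    then have even: "even s" by simp
    have "a \<le> Suc s div 2" "a - 1 \<le> Suc s div 2" using step.prems by presburger+
    then show ?thesis
      using IH[of a] IH[of "a - 1"] IH[of 0] qt_chain_step_even[OF step.hyps(2) even step.prems]
      by (cases "a = 0") auto
  qed
qed

lemma diag_entry_range:
  assumes "1 \<le> i" "d \<le> k" "2 * i + d \<le> k + 2"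
  shows "diag_entry k g i d \<in> {0..c}"
  unfolding diag_entry_def by (rule qt_chain_range) (use assms in auto)

text \<open>In terms of cells, the first claim is a step to the right and the second a step down.
  The last two compare a cell next to the antidiagonal with a neighbour on it: the complement of the
  former will stand on the other side of the latter.\<close>

lemma diag_entry_step:
  assumes "1 \<le> i" "d < k" "2 * i + d + 1 \<le> k + 2"
  shows "diag_entry k g i (Suc d) \<le> diag_entry k g i d"
    and "2 * i + d + 2 \<le> k + 2 \<Longrightarrow> diag_entry k g (Suc i) d \<le> diag_entry k g i (Suc d)"
    and "2 * i + d + 1 = k + 2 \<Longrightarrow> c \<le> diag_entry k g i d + diag_entry k g i (Suc d)"
    and "2 * i + d + 2 = k + 2 \<Longrightarrow> c \<le> diag_entry k g (Suc i) d + diag_entry k g i (Suc d)"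
proof -
  define s where "s = k - Suc d"
  have s: "s < k" "k - Suc d = s" "k - d = Suc s" "k = Suc s + d"
    using assms by (simp_all add: s_def)
  define u where "u = s div 2"
  define a where "a = Suc u - i"
  have "diag_entry k g i (Suc d) \<le> diag_entry k g i d
    \<and> (2 * i + d + 2 \<le> k + 2 \<longrightarrow> diag_entry k g (Suc i) d \<le> diag_entry k g i (Suc d))
    \<and> (2 * i + d + 1 = k + 2 \<longrightarrow> c \<le> diag_entry k g i d + diag_entry k g i (Suc d))
    \<and> (2 * i + d + 2 = k + 2 \<longrightarrow> c \<le> diag_entry k g (Suc i) d + diag_entry k g i (Suc d))"
  proof (cases "odd s")
    case True
    then have su: "s = 2 * u + 1" by (simp add: u_def)
    have i: "i \<le> Suc u" using assms(3) s(4) su by simp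
    have a: "a \<le> s div 2" "Suc (Suc u) - i = Suc a" "Suc u - i = a"
      using i assms(1) su by (auto simp: a_def)
    have entries: "diag_entry k g i (Suc d) = g s a" "diag_entry k g i d = g (Suc s) (Suc a)"
      "diag_entry k g (Suc i) d = g (Suc s) a"
      using a su by (simp_all add: diag_entry_def s)
    note step = qt_chain_step_odd[OF s(1) True a(1)]
    \<comment> \<open>Row \<open>s\<close> meets the antidiagonal only for even \<open>s\<close>, so
      one of the two boundary cases cannot occur here.\<close>
    have "2 * i + d + 1 \<noteq> k + 2" using s(4) su by presburger
    moreover have "a = 0" if "2 * i + d + 2 = k + 2" using that s(4) su by (simp add: a_def)
    ultimately show ?thesis unfolding entries using step by auto
  next
    case False
    then have su: "s = 2 * u" and even: "even s" by (simp_all add: u_def)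
    have i: "i \<le> Suc u" using assms(3) s(4) su by simp
    have a: "a \<le> s div 2" "Suc u - i = a" "Suc u - Suc i = a - 1"
      using i assms(1) su by (auto simp: a_def)
    have entries: "diag_entry k g i (Suc d) = g s a" "diag_entry k g i d = g (Suc s) a"
      "diag_entry k g (Suc i) d = g (Suc s) (a - 1)"
      using a su by (simp_all add: diag_entry_def s)
    note step = qt_chain_step_even[OF s(1) even a(1)]
    have "2 * i + d + 2 \<noteq> k + 2" using s(4) su by presburger
    moreover have "a = 0" if "2 * i + d + 1 = k + 2" using that s(4) su by (simp add: a_def)
    moreover have "a > 0" if "2 * i + d + 2 \<le> k + 2" using that s(4) su by (simp add: a_def)
    ultimately show ?thesis unfolding entries using step by auto
  qed
  then show "diag_entry k g i (Suc d) \<le> diag_entry k g i d"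
    and "2 * i + d + 2 \<le> k + 2 \<Longrightarrow> diag_entry k g (Suc i) d \<le> diag_entry k g i (Suc d)"
    and "2 * i + d + 1 = k + 2 \<Longrightarrow> c \<le> diag_entry k g i d + diag_entry k g i (Suc d)"
    and "2 * i + d + 2 = k + 2 \<Longrightarrow> c \<le> diag_entry k g (Suc i) d + diag_entry k g i (Suc d)"
    by blast+
qed

end

context
  fixes c :: int and k :: nat and x g h
  assumes x: "x \<in> qt_tops c k" and g: "g \<in> row_chains (qt_rows c) k x"
    and h: "h \<in> row_chains (qt_rows c) k x"
begin

text \<open>On the main diagonal either chain may be read, since both have the same last
  row.\<close>

lemma staircase_entry_below:
  assumes "j \<le> i"
  shows "staircase_entry k g h i j = diag_entry k h j (i - j)"
proof (cases "i = j")
  case True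
  then show ?thesis using g h by (simp add: staircase_entry_def diag_entry_def row_chains_def)
qed (use assms in \<open>simp add: staircase_entry_def\<close>)

lemma staircase_entry_range:
  assumes "1 \<le> i" "1 \<le> j" "i + j \<le> k + 2"
  shows "staircase_entry k g h i j \<in> {0..c}"
  unfolding staircase_entry_def
  using diag_entry_range[OF x g, of i "j - i"] diag_entry_range[OF x h, of j "i - j"] assms by auto

lemma staircase_entry_step:
  assumes "1 \<le> i" "1 \<le> j" "i + j \<le> k + 1"
  shows "staircase_entry k g h (Suc i) j \<le> staircase_entry k g h i j"
    and "staircase_entry k g h i (Suc j) \<le> staircase_entry k g h i j"
    and "i + j = k + 1 \<Longrightarrow> c \<le> staircase_entry k g h i j + staircase_entry k g h (Suc i) j"
    and "i + j = k + 1 \<Longrightarrow> c \<le> staircase_entry k g h i j + staircase_entry k g h i (Suc j)"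
proof -
  have "staircase_entry k g h (Suc i) j \<le> staircase_entry k g h i j \<and>
    (i + j = k + 1 \<longrightarrow> c \<le> staircase_entry k g h i j + staircase_entry k g h (Suc i) j)"
  \<comment> \<open>In each case both cells lie weakly on one side of the main diagonal, so a single
    chain covers the step.\<close>
  proof (cases "i < j")
    case True
    define d where "d = j - Suc i"
    have d: "j - i = Suc d" "j - Suc i = d" "j = Suc (i + d)" using True by (simp_all add: d_def)
    show ?thesis
      using diag_entry_step(2,4)[OF x g, of i d] assms True d
      by (simp add: staircase_entry_def add.commute)
  next
    case False
    define d where "d = i - j"
    have d: "i - j = d" "Suc i - j = Suc d" "i = j + d" using False by (simp_all add: d_def)
    have "d < k" using d assms by simp
    then show ?thesis
      using diag_entry_step(1,3)[OF x h, of j d] assms False d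
      by (simp add: staircase_entry_below)
  qed
  then show "staircase_entry k g h (Suc i) j \<le> staircase_entry k g h i j"
    and "i + j = k + 1 \<Longrightarrow> c \<le> staircase_entry k g h i j + staircase_entry k g h (Suc i) j"
    by blast+
  have "staircase_entry k g h i (Suc j) \<le> staircase_entry k g h i j \<and>
    (i + j = k + 1 \<longrightarrow> c \<le> staircase_entry k g h i j + staircase_entry k g h i (Suc j))"
  proof (cases "j < i")
    case True
    define d where "d = i - Suc j"
    have d: "i - j = Suc d" "i - Suc j = d" "i = Suc (j + d)" using True by (simp_all add: d_def)
    show ?thesis
      using diag_entry_step(2,4)[OF x h, of j d] assms True d
      by (simp add: staircase_entry_below add.commute)
  next
    case False
    define d where "d = j - i"
    have d: "j - i = d" "Suc j - i = Suc d" "j = i + d" using False by (simp_all add: d_def)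
    have "d < k" using d assms by simp
    then show ?thesis
      using diag_entry_step(1,3)[OF x g, of i d] assms False d
      by (simp add: staircase_entry_def)
  qed
  then show "staircase_entry k g h i (Suc j) \<le> staircase_entry k g h i j"
    and "i + j = k + 1 \<Longrightarrow> c \<le> staircase_entry k g h i j + staircase_entry k g h i (Suc j)"
    by blast+
qed

end

lemma staircase_plane_partition:
  assumes "\<pi> \<in> plane_partitions (Suc k) (Suc k) c" "quasi_transpose_complementary (Suc k) c \<pi>"
  shows "\<And>i j. 1 \<le> i \<Longrightarrow> i \<le> Suc k \<Longrightarrow> 1 \<le> j \<Longrightarrow> j \<le> Suc k \<Longrightarrow> \<pi> (i, j) \<in> {0..int c}"
    and "\<And>i j. 1 \<le> i \<Longrightarrow> i \<le> k \<Longrightarrow> 1 \<le> j \<Longrightarrow> j \<le> Suc k \<Longrightarrow> \<pi> (Suc i, j) \<le> \<pi> (i, j)"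
    and "\<And>i j. 1 \<le> i \<Longrightarrow> i \<le> Suc k \<Longrightarrow> 1 \<le> j \<Longrightarrow> j \<le> k \<Longrightarrow> \<pi> (i, Suc j) \<le> \<pi> (i, j)"
    and "\<And>i j. 1 \<le> i \<Longrightarrow> i \<le> Suc k \<Longrightarrow> 1 \<le> j \<Longrightarrow> j \<le> Suc k \<Longrightarrow> i + j \<noteq> k + 2 \<Longrightarrow>
      \<pi> (i, j) + \<pi> (k + 2 - j, k + 2 - i) = int c"
proof -
  fix i j
  assume *: "1 \<le> i" "i \<le> Suc k" "1 \<le> j" "j \<le> Suc k" "i + j \<noteq> k + 2"
  then have "i \<noteq> Suc k + 1 - j" by linarith
  then have "\<pi> (i, j) + \<pi> (Suc k + 1 - j, Suc k + 1 - i) = int c"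
    using assms(2) * unfolding quasi_transpose_complementary_def by auto
  then show "\<pi> (i, j) + \<pi> (k + 2 - j, k + 2 - i) = int c" by simp
qed (use assms(1) in \<open>auto simp: plane_partitions_def PiE_iff\<close>)

lemma diag_rows_chain:
  assumes \<pi>: "\<pi> \<in> plane_partitions (Suc k) (Suc k) c" "quasi_transpose_complementary (Suc k) c \<pi>"
  shows "diag_rows k \<pi> k \<in> qt_tops (int c) k"
    and "diag_rows k \<pi> \<in> row_chains (qt_rows (int c)) k (diag_rows k \<pi> k)"
proof -
  note range = staircase_plane_partition(1)[OF \<pi>]
  note down = staircase_plane_partition(2)[OF \<pi>]
  note right = staircase_plane_partition(3)[OF \<pi>]
  \<comment> \<open>These two cells are complementary neighbours of the antidiagonal. The
    antidiagonal cells \<open>(i, j + 1)\<close> and \<open>(i + 1, j)\<close> are squeezed between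
    them, which produces the folded lower ends in \<open>qt_rows\<close>.\<close>
  have comp: "\<pi> (i, j) + \<pi> (Suc i, Suc j) = int c" if "1 \<le> i" "1 \<le> j" "i + j = Suc k" for i j
  proof -
    have "k + 2 - j = Suc i" "k + 2 - i = Suc j" using that by simp_all
    then show ?thesis using staircase_plane_partition(4)[OF \<pi>, of i j] that by simp
  qed
  have entry: "diag_rows k \<pi> t a = \<pi> (Suc (t div 2) - a, Suc (t div 2) - a + (k - t))"
    if "t \<le> k" "a \<le> t div 2" for t a
    using that by (simp add: diag_rows_def)
  show "diag_rows k \<pi> k \<in> qt_tops (int c) k"
  proof -
    let ?x = "diag_rows k \<pi> k" and ?L = "Suc (k div 2)"
    have "?x \<in> {..<?L} \<rightarrow>\<^sub>E {0..int c}"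
      using range by (auto simp: diag_rows_def)
    moreover have "?x a \<le> ?x (Suc a)" if "a < k div 2" for a
    proof -
      define i where "i = k div 2 - a"
      have i: "1 \<le> i" "i \<le> k" "?L - a = Suc i" "?L - Suc a = i" using that by (auto simp: i_def)
      have "\<pi> (Suc i, Suc i) \<le> \<pi> (i, i)"
        using down[of i "Suc i"] right[of i i] i by simp
      then show ?thesis using that i by (simp add: entry)
    qed
    moreover have "int c \<le> 2 * ?x 0" if "odd k"
    proof -
      have "?L + ?L = Suc k" using that by presburger
      then show ?thesis
        using comp[of ?L ?L] down[of ?L "Suc ?L"] right[of ?L ?L] by (simp add: entry)
    qed
    moreover have "int c - ?x 0 \<le> ?x 1" if "even k" "k > 0"
    proof -
      define u where "u = k div 2"
      have u: "u + Suc u = Suc k" "u \<ge> 1" "k div 2 = u" using that by (auto simp: u_def)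
      then show ?thesis
        using comp[of u "Suc u"] right[of u u] right[of "Suc u" "Suc u"] entry[of k 1] entry[of k 0] by simp
    qed
    ultimately show ?thesis by (simp add: qt_tops_def qt_top_def)
  qed
  have "diag_rows k \<pi> s \<in> qt_rows (int c) s (diag_rows k \<pi> (Suc s))" if "s < k" for s
  proof -
    define d where "d = k - Suc s"
    have d: "k - s = Suc d" "k - Suc s = d" "k = Suc s + d" using that by (simp_all add: d_def)
    define u where "u = s div 2"
    let ?y = "diag_rows k \<pi> s" and ?x = "diag_rows k \<pi> (Suc s)"
    have "?y a \<in> (if odd s then {(if a = 0 then max (?x 0) (int c - ?x 0) else ?x a)..?x (Suc a)}
        else {(if a = 0 then int c - ?x 0 else ?x (a - 1))..?x a})" if a: "a \<le> u" for a
    proof -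
      define i where "i = Suc u - a"
      have i: "1 \<le> i" "Suc u - a = i" using a by (simp_all add: i_def)
      have ya: "?y a = \<pi> (i, i + Suc d)"
        using a that d i entry[of s a] by (simp add: u_def)
      show ?thesis
      proof (cases "odd s")
        case True
        then have s: "s = 2 * u + 1" by (simp add: u_def)
        have len: "i + (i + Suc d) \<le> Suc k" using s d(3) a by (simp add: i_def)
        have xa: "?x a = \<pi> (Suc i, Suc i + d)" "?x (Suc a) = \<pi> (i, i + d)"
          using a s d entry[of "Suc s" a] entry[of "Suc s" "Suc a"] by (simp_all add: i_def Suc_diff_le)
        have "\<pi> (Suc i, Suc i + d) \<le> \<pi> (i, i + Suc d)" "\<pi> (i, i + Suc d) \<le> \<pi> (i, i + d)"
          using down[of i "i + Suc d"] right[of i "i + d"] len i(1) by simp_all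
        moreover have "int c - ?x 0 \<le> ?y a" if "a = 0"
        proof -
          have sum: "i + (i + Suc d) = Suc k" using s d(3) that by (simp add: i_def)
          have "\<pi> (Suc i, Suc (i + Suc d)) \<le> \<pi> (Suc i, i + Suc d)"
            using right[of "Suc i" "i + Suc d"] sum i(1) by simp
          then show ?thesis
            using comp[of i "i + Suc d"] sum i(1) that xa(1) ya by simp
        qed
        ultimately show ?thesis using True ya xa by auto
      next
        case False
        then have s: "s = 2 * u" by (simp add: u_def)
        have len: "i + (i + d) \<le> Suc k" using s d(3) a by (simp add: i_def)
        have xa: "?x a = \<pi> (i, i + d)"
          using a s d entry[of "Suc s" a] by (simp add: i_def)
        have "?y a \<le> ?x a"
          unfolding ya xa using right[of i "i + d"] len i(1) by simp
        moreover have "?x (a - 1) \<le> ?y a" if "a > 0"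
        proof -
          have "?x (a - 1) = \<pi> (Suc i, Suc i + d)"
            using a s d that entry[of "Suc s" "a - 1"] by (simp add: i_def Suc_diff_le)
          moreover have "i \<le> k" "i + Suc d \<le> Suc k"
            using len s d(3) a that by (simp_all add: i_def)
          then have "\<pi> (Suc i, i + Suc d) \<le> \<pi> (i, i + Suc d)"
            using i(1) by (intro down) simp_all
          ultimately show ?thesis by (simp add: ya)
        qed
        moreover have "int c - ?x 0 \<le> ?y a" if "a = 0"
        proof -
          have sum: "i + (i + d) = Suc k" using s d(3) that by (simp add: i_def)
          show ?thesis
            using comp[of i "i + d"] down[of i "i + Suc d"] sum i(1) that xa ya by simp
        qed
        ultimately show ?thesis using False by auto
      qed
    qed
    moreover have "?y a = undefined" if "\<not> a \<le> u" for a
      using that \<open>s < k\<close> by (simp add: diag_rows_def u_def)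
    ultimately show ?thesis
      unfolding qt_rows_def PiE_iff extensional_def u_def by (auto simp del: atLeastAtMost_iff)
  qed
  then show "diag_rows k \<pi> \<in> row_chains (qt_rows (int c)) k (diag_rows k \<pi> k)"
    by (auto simp: row_chains_def diag_rows_def)
qed

text \<open>Transposing commutes with the reflection in the antidiagonal. Hence the cells below the
  main diagonal can be read by \<open>diag_rows\<close> as well.\<close>

lemma transpose_quasi_transpose_complementary:
  assumes \<pi>: "\<pi> \<in> plane_partitions (Suc k) (Suc k) c" "quasi_transpose_complementary (Suc k) c \<pi>"
  shows "\<pi> \<circ> prod.swap \<in> plane_partitions (Suc k) (Suc k) c"
    and "quasi_transpose_complementary (Suc k) c (\<pi> \<circ> prod.swap)"
proof -
  show "\<pi> \<circ> prod.swap \<in> plane_partitions (Suc k) (Suc k) c"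
    using \<pi>(1) unfolding plane_partitions_def by (auto simp: PiE_iff extensional_def)
  show "quasi_transpose_complementary (Suc k) c (\<pi> \<circ> prod.swap)"
    unfolding quasi_transpose_complementary_def
  proof (intro ballI impI)
    fix i j assume ij: "i \<in> {1..Suc k}" "j \<in> {1..Suc k}" "i \<noteq> Suc k + 1 - j"
    then have "j + i \<noteq> k + 2" by auto
    then show "(\<pi> \<circ> prod.swap) (i, j) + (\<pi> \<circ> prod.swap) (Suc k + 1 - j, Suc k + 1 - i) = int c"
      using staircase_plane_partition(4)[OF \<pi>, of j i] ij by simp
  qed
qed

text \<open>Inside the staircase the parts on the two sides of the main diagonal share only that
  diagonal, and given it they are chosen independently; hence the square.\<close>

lemma card_quasi_transpose_complementary:
  "card {\<pi> \<in> plane_partitions (Suc k) (Suc k) c. quasi_transpose_complementary (Suc k) c \<pi>}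
    = (\<Sum>x\<in>qt_tops (int c) k. (chain_count (qt_rows (int c)) k x)\<^sup>2)"
proof -
  let ?P = "{\<pi> \<in> plane_partitions (Suc k) (Suc k) c. quasi_transpose_complementary (Suc k) c \<pi>}"
  let ?C = "row_chains (qt_rows (int c)) k"
  let ?S = "SIGMA x:qt_tops (int c) k. ?C x \<times> ?C x"
  let ?f = "\<lambda>\<pi>. (diag_rows k \<pi> k, diag_rows k \<pi>, diag_rows k (\<pi> \<circ> prod.swap))"
  let ?f' = "\<lambda>(x, g, h). qt_array (int c) k g h"
  have "bij_betw ?f ?P ?S"
  proof (rule bij_betw_byWitness[where f' = ?f'])
    show "\<forall>\<pi>\<in>?P. ?f' (?f \<pi>) = \<pi>"
    proof
      fix \<pi> assume "\<pi> \<in> ?P"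
      then have \<pi>: "\<pi> \<in> plane_partitions (Suc k) (Suc k) c" "quasi_transpose_complementary (Suc k) c \<pi>"
        by auto
      have entry: "diag_entry k (diag_rows k \<rho>) i d = \<rho> (i, i + d)"
        if "1 \<le> i" "2 * i + d \<le> k + 2" for \<rho> i d
      proof -
        have "d \<le> k" "i \<le> Suc ((k - d) div 2)" using that by linarith+
        then show ?thesis using that by (simp add: diag_entry_def diag_rows_def)
      qed
      have stair: "staircase_entry k (diag_rows k \<pi>) (diag_rows k (\<pi> \<circ> prod.swap)) i j = \<pi> (i, j)"
        if "1 \<le> i" "1 \<le> j" "i + j \<le> k + 2" for i j
        using that by (simp add: staircase_entry_def entry)
      have "qt_array (int c) k (diag_rows k \<pi>) (diag_rows k (\<pi> \<circ> prod.swap)) (i, j) = \<pi> (i, j)"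
        if "1 \<le> i" "i \<le> Suc k" "1 \<le> j" "j \<le> Suc k" for i j
      proof (cases "i + j \<le> k + 2")
        case True
        then show ?thesis using that by (simp add: qt_array_def stair)
      next
        case False
        then show ?thesis
          using that staircase_plane_partition(4)[OF \<pi>, of i j] stair[of "k + 2 - j" "k + 2 - i"]
          by (simp add: qt_array_def)
      qed
      moreover have "\<pi> \<in> extensional ({1..Suc k} \<times> {1..Suc k})"
        using \<pi>(1) by (auto simp: plane_partitions_def PiE_def)
      ultimately show "?f' (?f \<pi>) = \<pi>"
        by (intro extensionalityI[of _ "{1..Suc k} \<times> {1..Suc k}"]) (auto simp: qt_array_def)
    qed
    show "\<forall>z\<in>?S. ?f (?f' z) = z"
    proof
      fix z assume "z \<in> ?S"
      then obtain x g h where z: "z = (x, g, h)" and x: "x \<in> qt_tops (int c) k"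
        and g: "g \<in> ?C x" and h: "h \<in> ?C x"
        by auto
      let ?\<pi> = "qt_array (int c) k g h"
      have idx: "i + (i + (k - t)) \<le> k + 2" "1 \<le> i" "i \<le> Suc k" "i + (k - t) \<le> Suc k" "k - (k - t) = t"
        if "t \<le> k" "a < Suc (t div 2)" "i = Suc (t div 2) - a" for t a i
        using that by linarith+
      have rows: "diag_rows k ?\<pi> t = g t" "diag_rows k (?\<pi> \<circ> prod.swap) t = h t" for t
      proof -
        show "diag_rows k ?\<pi> t = g t"
        proof (cases "t \<le> k")
          case True
          show ?thesis
          proof (rule extensionalityI[of _ "{..<Suc (t div 2)}"])
            fix a assume a: "a \<in> {..<Suc (t div 2)}"
            define i where "i = Suc (t div 2) - a"
            define d where "d = k - t"
            note idx = idx[OF True _ i_def, folded d_def]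
            have "diag_rows k ?\<pi> t a = diag_entry k g i d"
              using True a idx by (simp add: diag_rows_def i_def[symmetric] d_def[symmetric] qt_array_def staircase_entry_def)
            also have "\<dots> = g t a"
              using a idx(5) by (simp add: diag_entry_def i_def)
            finally show "diag_rows k ?\<pi> t a = g t a" .
          qed (use True qt_chain_extensional[OF x g True] in \<open>simp_all add: diag_rows_def\<close>)
        next
          case False
          then show ?thesis using g by (simp add: diag_rows_def row_chains_def)
        qed
        show "diag_rows k (?\<pi> \<circ> prod.swap) t = h t"
        proof (cases "t \<le> k")
          case True
          show ?thesis
          proof (rule extensionalityI[of _ "{..<Suc (t div 2)}"])
            fix a assume a: "a \<in> {..<Suc (t div 2)}"
            define i where "i = Suc (t div 2) - a"
            define d where "d = k - t"
            note idx = idx[OF True _ i_def, folded d_def]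
            have "diag_rows k (?\<pi> \<circ> prod.swap) t a = diag_entry k h i d"
              using True a idx staircase_entry_below[OF x g h, of i "i + d"]
              by (simp add: diag_rows_def i_def[symmetric] d_def[symmetric] qt_array_def add.commute)
            also have "\<dots> = h t a"
              using a idx(5) by (simp add: diag_entry_def i_def)
            finally show "diag_rows k (?\<pi> \<circ> prod.swap) t a = h t a" .
          qed (use True qt_chain_extensional[OF x h True] in \<open>simp_all add: diag_rows_def\<close>)
        next
          case False
          then show ?thesis using h by (simp add: diag_rows_def row_chains_def)
        qed
      qed
      then have "diag_rows k ?\<pi> = g" "diag_rows k (?\<pi> \<circ> prod.swap) = h" by blast+
      moreover have "g k = x" using g by (simp add: row_chains_def)
      ultimately show "?f (?f' z) = z" by (simp add: z)
    qed
    show "?f ` ?P \<subseteq> ?S"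
    proof
      fix z assume "z \<in> ?f ` ?P"
      then obtain \<pi> where z: "z = ?f \<pi>"
        and \<pi>: "\<pi> \<in> plane_partitions (Suc k) (Suc k) c" "quasi_transpose_complementary (Suc k) c \<pi>"
        by auto
      have "diag_rows k (\<pi> \<circ> prod.swap) k = diag_rows k \<pi> k"
        by (simp add: diag_rows_def)
      then show "z \<in> ?S"
        using diag_rows_chain[OF \<pi>] diag_rows_chain[OF transpose_quasi_transpose_complementary[OF \<pi>]]
        by (simp add: z)
    qed
    show "?f' ` ?S \<subseteq> ?P"
    proof
      fix \<pi> assume "\<pi> \<in> ?f' ` ?S"
      then obtain x g h where \<pi>: "\<pi> = qt_array (int c) k g h" and x: "x \<in> qt_tops (int c) k"
        and g: "g \<in> ?C x" and h: "h \<in> ?C x"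
        by auto
      let ?s = "staircase_entry k g h"
      note range = staircase_entry_range[OF x g h]
      note step = staircase_entry_step[OF x g h]
      have upper: "\<pi> (i, j) = ?s i j" if "1 \<le> i" "1 \<le> j" "i + j \<le> k + 2" for i j
        using that by (simp add: \<pi> qt_array_def)
      have lower: "\<pi> (i, j) = int c - ?s (k + 2 - j) (k + 2 - i)"
        if "i \<le> Suc k" "j \<le> Suc k" "i + j > k + 2" for i j
        using that by (simp add: \<pi> qt_array_def)
      have "\<pi> \<in> {1..Suc k} \<times> {1..Suc k} \<rightarrow>\<^sub>E {0..int c}"
      proof -
        have "\<pi> (i, j) \<in> {0..int c}" if "1 \<le> i" "i \<le> Suc k" "1 \<le> j" "j \<le> Suc k" for i j
        proof (cases "i + j \<le> k + 2")
          case True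
          then show ?thesis using range[of i j] that by (simp add: upper)
        next
          case False
          then show ?thesis using range[of "k + 2 - j" "k + 2 - i"] that by (simp add: lower)
        qed
        then show ?thesis
          by (auto simp: PiE_iff \<pi> qt_array_def)
      qed
      moreover have "\<pi> (i + 1, j) \<le> \<pi> (i, j)" if ij: "1 \<le> i" "i + 1 \<le> Suc k" "1 \<le> j" "j \<le> Suc k" for i j
      proof -
        consider "i + j \<le> k + 1" | "i + j = k + 2" | "i + j > k + 2" by linarith
        then show ?thesis
        proof cases
          case 1
          then show ?thesis using step(1)[of i j] ij by (simp add: upper)
        next
          case 2
          \<comment> \<open>The step leads from an antidiagonal cell to the complement of the cell
            on its left, so it is the boundary inequality for these two adjacent cells.\<close>
          define j' where "j' = j - 1"
          have j: "j = Suc j'" "1 \<le> j'" using 2 ij by (simp_all add: j'_def)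
          have "k + 2 - j = i" "k + 2 - (i + 1) = j'" using 2 j by simp_all
          then have "\<pi> (i + 1, j) = int c - ?s i j'" using 2 ij lower[of "i + 1" j] by simp
          then show ?thesis using step(4)[of i j'] 2 ij j by (simp add: upper)
        next
          case 3
          have "Suc (k + 2 - (i + 1)) = k + 2 - i" using ij by simp
          then show ?thesis
            using step(2)[of "k + 2 - j" "k + 2 - (i + 1)"] 3 ij by (simp add: lower)
        qed
      qed
      moreover have "\<pi> (i, j + 1) \<le> \<pi> (i, j)" if ij: "1 \<le> i" "i \<le> Suc k" "1 \<le> j" "j + 1 \<le> Suc k" for i j
      proof -
        consider "i + j \<le> k + 1" | "i + j = k + 2" | "i + j > k + 2" by linarith
        then show ?thesis
        proof cases
          case 1
          then show ?thesis using step(2)[of i j] ij by (simp add: upper)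
        next
          case 2
          define i' where "i' = i - 1"
          have i: "i = Suc i'" "1 \<le> i'" using 2 ij by (simp_all add: i'_def)
          have "k + 2 - i = j" "k + 2 - (j + 1) = i'" using 2 i by simp_all
          then have "\<pi> (i, j + 1) = int c - ?s i' j" using 2 ij lower[of i "j + 1"] by simp
          then show ?thesis using step(3)[of i' j] 2 ij i by (simp add: upper)
        next
          case 3
          have "Suc (k + 2 - (j + 1)) = k + 2 - j" using ij by simp
          then show ?thesis
            using step(1)[of "k + 2 - (j + 1)" "k + 2 - i"] 3 ij by (simp add: lower)
        qed
      qed
      moreover have "quasi_transpose_complementary (Suc k) c \<pi>"
        unfolding quasi_transpose_complementary_def
      proof (intro ballI impI)
        fix i j assume ij: "i \<in> {1..Suc k}" "j \<in> {1..Suc k}" "i \<noteq> Suc k + 1 - j"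
        then consider "i + j < k + 2" | "i + j > k + 2" by fastforce
        then have "\<pi> (i, j) + \<pi> (k + 2 - j, k + 2 - i) = int c"
        proof cases
          case 1
          then show ?thesis using ij lower[of "k + 2 - j" "k + 2 - i"] by (simp add: upper)
        next
          case 2
          then show ?thesis using ij upper[of "k + 2 - j" "k + 2 - i"] by (simp add: lower)
        qed
        then show "\<pi> (i, j) + \<pi> (Suc k + 1 - j, Suc k + 1 - i) = int c" by simp
      qed
      ultimately show "\<pi> \<in> ?P"
        by (simp add: plane_partitions_def)
    qed
  qed
  then have "card ?P = card ?S" by (rule bij_betw_same_card)
  also have "\<dots> = (\<Sum>x\<in>qt_tops (int c) k. card (?C x \<times> ?C x))"
  proof (rule card_SigmaI)
    show "finite (qt_tops (int c) k)"
      by (rule finite_subset[of _ "{..<Suc (k div 2)} \<rightarrow>\<^sub>E {0..int c}"]) (auto simp: qt_tops_def finite_PiE)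
  qed (use card_row_chains finite_qt_rows in blast)
  also have "\<dots> = (\<Sum>x\<in>qt_tops (int c) k. (chain_count (qt_rows (int c)) k x)\<^sup>2)"
    using card_row_chains[OF finite_qt_rows] by (simp add: card_cartesian_product power2_eq_square)
  finally show ?thesis .
qed

section \<open>From weakly to strictly increasing sequences\<close>

lemma incseqs_gap:
  assumes "x \<in> incseqs n X" "i \<le> j" "j < n"
  shows "x i + int (j - i) \<le> x j"
  using assms(2,3)
proof (induction rule: dec_induct)
  case (step j)
  then show ?case
    using incseqs_less[OF assms(1), of j "Suc j"] by (simp add: Suc_diff_le)
qed simp

text \<open>Adding \<open>i\<close> to entry \<open>i\<close> makes the last row strictly
  increasing, and the offset \<open>a = - int c\<close> turns the arguments into
  \<open>2 * y i - N\<close> with \<open>N = c + k\<close>, centred in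
  \<open>{0..N}\<close>.\<close>

lemma real_card_symmetric_pp:
  assumes f: "central_family f"
  shows "real (card {\<pi> \<in> plane_partitions (Suc k) (Suc k) c. symmetric_pp (Suc k) \<pi>})
    = (\<Sum>y\<in>incseqs (Suc k) {0..int (c + k)}. rdet (Suc k) (\<lambda>i j. f j (2 * y i - int (c + k))))"
proof -
  have "real (card {\<pi> \<in> plane_partitions (Suc k) (Suc k) c. symmetric_pp (Suc k) \<pi>})
      = (\<Sum>x\<in>gt_tops (int c) k. rdet (Suc k) (\<lambda>i j. f j (2 * x i + (2 * int i - int k + - int c))))"
    unfolding card_symmetric_pp of_nat_sum
    by (intro sum.cong refl gt_chain_count[OF f]) (auto simp: gt_tops_def)
  also have "\<dots> = (\<Sum>y\<in>incseqs (Suc k) {0..int (c + k)}. rdet (Suc k) (\<lambda>i j. f j (2 * y i - int (c + k))))"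
  proof (rule sum.reindex_bij_witness[of _ "\<lambda>y. \<lambda>i\<in>{..<Suc k}. y i - int i" "\<lambda>x. \<lambda>i\<in>{..<Suc k}. x i + int i"])
    fix x assume x: "x \<in> gt_tops (int c) k"
    then have ext: "x i = undefined" if "\<not> i < Suc k" for i
      using that by (auto simp: gt_tops_def PiE_iff extensional_def)
    then show "(\<lambda>i\<in>{..<Suc k}. (\<lambda>i\<in>{..<Suc k}. x i + int i) i - int i) = x"
      by (auto simp: fun_eq_iff)
    have "0 \<le> x i" "x i \<le> int c" if "i < Suc k" for i
      using x that by (auto simp: gt_tops_def PiE_iff)
    moreover have "x i \<le> x (Suc i)" if "i < k" for i
      using x that by (auto simp: gt_tops_def)
    ultimately show "(\<lambda>i\<in>{..<Suc k}. x i + int i) \<in> incseqs (Suc k) {0..int (c + k)}"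
      by (force simp: incseqs_def)
    show "rdet (Suc k) (\<lambda>i j. f j (2 * (\<lambda>i\<in>{..<Suc k}. x i + int i) i - int (c + k)))
        = rdet (Suc k) (\<lambda>i j. f j (2 * x i + (2 * int i - int k + - int c)))"
      by (rule rdet_cong) (simp add: algebra_simps)
  next
    fix y assume y: "y \<in> incseqs (Suc k) {0..int (c + k)}"
    have ext: "y i = undefined" if "\<not> i < Suc k" for i
      using y that by (auto simp: incseqs_def PiE_iff extensional_def)
    then show "(\<lambda>i\<in>{..<Suc k}. (\<lambda>i\<in>{..<Suc k}. y i - int i) i + int i) = y"
      by (auto simp: fun_eq_iff)
    have mem: "0 \<le> y i" "y i \<le> int (c + k)" if "i < Suc k" for i
      using y that by (auto simp: incseqs_def PiE_iff)
    have "0 \<le> y i - int i" "y i - int i \<le> int c" if "i < Suc k" for i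
      using mem(1)[of 0] mem(2)[of k] incseqs_gap[OF y, of 0 i] incseqs_gap[OF y, of i k] that by auto
    moreover have "y i - int i \<le> y (Suc i) - int (Suc i)" if "i < k" for i
      using incseqs_less[OF y, of i "Suc i"] that by simp
    ultimately show "(\<lambda>i\<in>{..<Suc k}. y i - int i) \<in> gt_tops (int c) k"
      by (auto simp: gt_tops_def)
  qed
  finally show ?thesis .
qed

lemma real_card_quasi_transpose_complementary:
  assumes f: "central_family f"
  shows "real (card {\<pi> \<in> plane_partitions (Suc k) (Suc k) c. quasi_transpose_complementary (Suc k) c \<pi>})
    = 4 ^ (Suc k div 2) * (\<Sum>y\<in>mirror_domain k (int (c + k)).
        det_product f (Suc (k div 2)) (k mod 2) (int (c + k)) y)"
proof -
  define L where "L = Suc (k div 2)"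
  \<comment> \<open>\<open>e\<close> is \<open>k / 2\<close> rounded up, so
    \<open>2 * e - k = k mod 2\<close>. This shift moves the rows into the same interval
    \<open>{0..c + k}\<close> as for symmetric plane partitions.\<close>
  define e where "e = int (k - k div 2)"
  define N where "N = int (c + k)"
  have ek: "2 * e = int k + int (k mod 2)" "int (k div 2) + e = int k"
  proof -
    have "2 * (k - k div 2) = k + k mod 2" "k div 2 + (k - k div 2) = k" by presburger+
    then have "int (2 * (k - k div 2)) = int (k + k mod 2)" "int (k div 2 + (k - k div 2)) = int k"
      by (simp_all only:)
    then show "2 * e = int k + int (k mod 2)" "int (k div 2) + e = int k"
      by (simp_all only: e_def of_nat_mult of_nat_add of_nat_numeral)
  qed
  let ?shift = "\<lambda>x. \<lambda>i\<in>{..<L}. x i + int i + e"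
  have square: "(real (chain_count (qt_rows (int c)) k x))\<^sup>2
      = 4 ^ (Suc k div 2) * det_product f L (k mod 2) N (?shift x)" if "x \<in> qt_tops (int c) k" for x
  proof -
    have top: "qt_top (int c) k x" using that by (simp add: qt_tops_def)
    have arg: "rdet L (\<lambda>i j. f' (2 * j + k mod 2) (2 * x i + (2 * int i + int (k mod 2) - int c)))
        = rdet L (\<lambda>i j. f' (2 * j + k mod 2) (2 * ?shift x i - N))" for f' :: "nat \<Rightarrow> int \<Rightarrow> real"
    proof (rule rdet_cong)
      fix i j assume "i < L"
      then have "2 * ?shift x i - N = 2 * x i + (2 * int i + int (k mod 2) - int c)"
        using ek(1) by (simp add: N_def)
      then show "f' (2 * j + k mod 2) (2 * x i + (2 * int i + int (k mod 2) - int c))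
          = f' (2 * j + k mod 2) (2 * ?shift x i - N)" by simp
    qed
    have count: "real (chain_count (qt_rows (int c)) k x)
        = 2 ^ (Suc k div 2) * rdet L (\<lambda>i j. f' (2 * j + k mod 2) (2 * ?shift x i - N))"
      if "central_family f'" for f'
      unfolding arg[symmetric] unfolding L_def by (rule qt_chain_count[OF that top])
    \<comment> \<open>The same number is evaluated twice, with the averaged family and with
      \<open>f\<close> itself, to match the mixed product in \<open>det_product\<close>.\<close>
    have "(real (chain_count (qt_rows (int c)) k x))\<^sup>2
        = (2 ^ (Suc k div 2) * rdet L (\<lambda>i j. averaged f (2 * j + k mod 2) (2 * ?shift x i - N)))
        * (2 ^ (Suc k div 2) * rdet L (\<lambda>i j. f (2 * j + k mod 2) (2 * ?shift x i - N)))"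
      unfolding power2_eq_square
      by (rule arg_cong2[where f = "(*)", OF count[OF central_family_averaged[OF f]] count[OF f]])
    also have "\<dots> = (2 ^ (Suc k div 2) * 2 ^ (Suc k div 2)) * det_product f L (k mod 2) N (?shift x)"
      by (simp only: det_product_def mult_ac)
    also have "2 ^ (Suc k div 2) * 2 ^ (Suc k div 2) = (4 :: real) ^ (Suc k div 2)"
      by (simp only: power_mult_distrib[symmetric]) simp
    finally show ?thesis .
  qed
  have "real (card {\<pi> \<in> plane_partitions (Suc k) (Suc k) c. quasi_transpose_complementary (Suc k) c \<pi>})
      = (\<Sum>x\<in>qt_tops (int c) k. 4 ^ (Suc k div 2) * det_product f L (k mod 2) N (?shift x))"
    unfolding card_quasi_transpose_complementary by (simp add: square)
  also have "\<dots> = 4 ^ (Suc k div 2) * (\<Sum>x\<in>qt_tops (int c) k. det_product f L (k mod 2) N (?shift x))"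
    by (simp only: sum_distrib_left)
  also have "(\<Sum>x\<in>qt_tops (int c) k. det_product f L (k mod 2) N (?shift x))
      = (\<Sum>y\<in>mirror_domain k N. det_product f L (k mod 2) N y)"
  proof (rule sum.reindex_bij_witness[of _ "\<lambda>y. \<lambda>i\<in>{..<L}. y i - int i - e" ?shift])
    fix x assume x: "x \<in> qt_tops (int c) k"
    then have "x i = undefined" if "\<not> i < L" for i
      using that by (auto simp: qt_tops_def PiE_iff extensional_def L_def)
    then show "(\<lambda>i\<in>{..<L}. ?shift x i - int i - e) = x"
      by (auto simp: fun_eq_iff)
    have mem: "0 \<le> x i" "x i \<le> int c" if "i < L" for i
      using x that by (auto simp: qt_tops_def PiE_iff L_def)
    have "x i \<le> x (Suc i)" if "Suc i < L" for i
      using x that by (auto simp: qt_tops_def qt_top_def L_def)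
    moreover have "int i + e \<le> int k" if "i < L" for i
      using that ek(2) by (simp add: L_def)
    moreover have "0 \<le> e" by (simp add: e_def)
    ultimately have inc: "?shift x \<in> incseqs L {0..N}"
      using mem by (force simp: incseqs_def N_def)
    show "?shift x \<in> mirror_domain k N"
    proof (cases "odd k")
      case True
      then have "int c \<le> 2 * x 0" using x by (simp add: qt_tops_def qt_top_def)
      moreover have "2 * e = int k + 1" using ek(1) True by (simp add: odd_iff_mod_2_eq_one)
      ultimately have "N < 2 * ?shift x 0" by (simp add: L_def N_def)
      with inc True show ?thesis by (simp add: mirror_domain_def L_def)
    next
      case False
      have "N < ?shift x 0 + ?shift x 1" if "k > 0"
      proof -
        have "1 < L" using False that by (auto simp: L_def elim!: evenE)
        moreover have "int c - x 0 \<le> x 1" using x that False by (simp add: qt_tops_def qt_top_def)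
        moreover have "2 * e = int k" using ek(1) False by (simp add: even_iff_mod_2_eq_zero)
        ultimately show ?thesis by (simp add: N_def)
      qed
      with inc False show ?thesis by (simp add: mirror_domain_def L_def)
    qed
    show "det_product f L (k mod 2) N (?shift x) = det_product f L (k mod 2) N (?shift x)" ..
  next
    fix y assume "y \<in> mirror_domain k N"
    then have y: "y \<in> incseqs L {0..N}"
      and dom: "if odd k then N < 2 * y 0 else k > 0 \<longrightarrow> N < y 0 + y 1"
      unfolding mirror_domain_def L_def by blast+
    have "y i = undefined" if "\<not> i < L" for i
      using y that by (auto simp: incseqs_def PiE_iff extensional_def)
    then show "?shift (\<lambda>i\<in>{..<L}. y i - int i - e) = y"
      by (auto simp: fun_eq_iff)
    have mem: "0 \<le> y i" "y i \<le> N" if "i < L" for i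
      using y that by (auto simp: incseqs_def PiE_iff)
    have "L > 0" by (simp add: L_def)
    have last: "y i + int (k div 2 - i) \<le> N" if "i < L" for i
      using incseqs_gap[OF y, of i "k div 2"] mem(2)[of "k div 2"] that by (simp add: L_def)
    \<comment> \<open>The lower bound comes from the reflection condition. For even
      \<open>k > 0\<close> it uses the upper bound too: \<open>y 1\<close> is at most
      \<open>N - (k div 2 - 1)\<close>, and \<open>N < y 0 + y 1\<close> then leaves at least
      \<open>k div 2\<close> for \<open>y 0\<close>.\<close>
    have first: "e \<le> y 0"
    proof (cases "odd k")
      case True
      then have "2 * e = int k + 1" using ek(1) by (simp add: odd_iff_mod_2_eq_one)
      with True dom show ?thesis by (simp add: N_def)
    next
      case False
      show ?thesis
      proof (cases "k = 0")
        case True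
        then show ?thesis using mem(1)[OF \<open>L > 0\<close>] by (simp add: e_def)
      next
        case False
        with \<open>\<not> odd k\<close> have "1 \<le> k div 2" by (auto elim!: evenE)
        moreover from this have "1 < L" by (simp add: L_def)
        moreover have "2 * e = int k" using ek(1) \<open>\<not> odd k\<close> by (simp add: even_iff_mod_2_eq_zero)
        ultimately show ?thesis
          using dom False \<open>\<not> odd k\<close> last[of 1] ek(2) by (simp add: of_nat_diff)
      qed
    qed
    have "0 \<le> y i - int i - e" "y i - int i - e \<le> int c" if "i < L" for i
    proof -
      show "0 \<le> y i - int i - e"
        using first incseqs_gap[OF y, of 0 i] that by simp
      have "i \<le> k div 2" using that by (simp add: L_def)
      then show "y i - int i - e \<le> int c"
        using last[OF that] ek(2) by (simp add: N_def of_nat_diff)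
    qed
    moreover have "y i - int i - e \<le> y (Suc i) - int (Suc i) - e" if "Suc i < L" for i
      using incseqs_less[OF y, of i "Suc i"] that by simp
    moreover have "int c \<le> 2 * (y 0 - e)" if "odd k"
    proof -
      have "2 * e = int k + 1" using ek(1) that by (simp add: odd_iff_mod_2_eq_one)
      with that dom show ?thesis by (simp add: N_def)
    qed
    moreover have "int c - (y 0 - e) \<le> y 1 - 1 - e" "1 < L" if "even k" "k > 0"
    proof -
      have "2 * e = int k" using ek(1) that by (simp add: even_iff_mod_2_eq_zero)
      with that dom show "int c - (y 0 - e) \<le> y 1 - 1 - e" by (simp add: N_def)
      show "1 < L" using that by (auto simp: L_def elim!: evenE)
    qed
    ultimately show "(\<lambda>i\<in>{..<L}. y i - int i - e) \<in> qt_tops (int c) k"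
      by (auto simp: qt_tops_def qt_top_def L_def)
  qed
  finally show ?thesis by (simp add: L_def N_def)
qed

theorem theorem1p2:
  fixes n c :: nat
  assumes "n \<ge> 1" and "c \<ge> 1"
  shows "card {\<pi> \<in> plane_partitions n n c. quasi_transpose_complementary n c \<pi>} =
         card {\<pi> \<in> plane_partitions n n c. symmetric_pp n \<pi>}"
proof -
  from assms obtain k where n: "n = Suc k"
    by (cases n) auto
  have "real (card {\<pi> \<in> plane_partitions n n c. quasi_transpose_complementary n c \<pi>}) =
        real (card {\<pi> \<in> plane_partitions n n c. symmetric_pp n \<pi>})"
    unfolding n real_card_symmetric_pp[OF central_family_central_binomial]
      real_card_quasi_transpose_complementary[OF central_family_central_binomial]
    by (rule sum_rdet_eq_sum_det_product[OF central_family_central_binomial, symmetric]) simp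
  then show ?thesis by simp
qed

end
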